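(* Let $S$ be the set of odd primes $p$ such that the multiplicative order $m_p$ of $2$ modulo $p$ is composite. Then, as $N\to\infty$, both $$\mathsf M_S(N)=o(\log N)\qquad\text{and}\qquad \mathsf M_{\mathbb P\setminus S}(N)=o(\log N).$$
   Context: $\mathbb P$ is the set of rational primes and $|\cdot|_p$ is the $p$-adic absolute value on $\mathbb Q$ with $|p|_p=p^{-1}$. For $S\subseteq\mathbb P$ let $R_S=\{r\in\mathbb Q: |r|_p\le 1\text{ for all }p\in\mathbb P\setminus S\}$, and let $T_S$ be the continuous endomorphism of the compact dual group $\widehat{R_S}$ dual to $r\mapsto 2r$ on the discrete group $R_S$. A closed orbit $\tau$ of length $|\tau|=n$ is a set $\{x,T_S(x),\dots,T_S^n(x)=x\}$ of cardinality $n$. Define $\mathsf M_S(N)=\sum_{|\tau|\le N}e^{-h|\tau|}$, the sum over closed orbits of $T_S$ of length at most $N$, where $h=h(T_S)$ is the topological entropy. It is known that $h(T_S)=\log 2$ and that the number of points with $T_S^nx=x$ is $(2^n-1)\prod_{p\in S}|2^n-1|_p$, so that, with $|x|_S=\prod_{p\in S}|x|_p$ and $\mu$ the Möbius function, $$\mathsf M_S(N)=\sum_{n\le N}\frac1{n2^n}\sum_{d\mid n}\mu(n/d)\,(2^d-1)\,|2^d-1|_S .$$ In particular $\mathsf M_S=\mathsf M_{S\cup\{2\}}$ for every $S$. *)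

theory Defs
  imports
    "HOL-Analysis.Analysis"
    "HOL-Number_Theory.Number_Theory"
    "HOL-Library.Landau_Symbols"
begin

definition padic_abs :: "nat \<Rightarrow> rat \<Rightarrow> real" where
  "padic_abs p r =
     (if r = 0 then 0
      else real p powi (int (multiplicity (int p) (snd (quotient_of r)))
                      - int (multiplicity (int p) (fst (quotient_of r)))))"

definition RS :: "nat set \<Rightarrow> rat set" where
  "RS S = {r. \<forall>p. prime p \<and> p \<notin> S \<longrightarrow> padic_abs p r \<le> 1}"

text \<open>
  The Pontryagin dual of a discrete abelian group, given as an additive subgroup \<open>A\<close> of
  an ambient type. Characters take the value \<^term>\<open>undefined\<close> outside \<open>A\<close>, so that equality
  of functions is equality of characters. As \<open>A\<close> is discrete, the compact-open topology is
  the topology of pointwise convergence on \<open>A\<close>.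
\<close>

definition characters :: "'a::ab_group_add set \<Rightarrow> ('a \<Rightarrow> complex) set" where
  "characters A =
     {\<psi> \<in> A \<rightarrow>\<^sub>E sphere 0 1. \<forall>r\<in>A. \<forall>s\<in>A. \<psi> (r + s) = \<psi> r * \<psi> s}"

definition dual_topology :: "'a::ab_group_add set \<Rightarrow> ('a \<Rightarrow> complex) topology" where
  "dual_topology A = subtopology (product_topology (\<lambda>_. euclidean) A) (characters A)"

definition dual_map ::
    "'a::ab_group_add set \<Rightarrow> ('a \<Rightarrow> 'a) \<Rightarrow> ('a \<Rightarrow> complex) \<Rightarrow> ('a \<Rightarrow> complex)" where
  "dual_map A f \<psi> = restrict (\<lambda>r. \<psi> (f r)) A"

definition dual_RS :: "nat set \<Rightarrow> (rat \<Rightarrow> complex) topology" where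
  "dual_RS S = dual_topology (RS S)"

definition TS :: "nat set \<Rightarrow> (rat \<Rightarrow> complex) \<Rightarrow> (rat \<Rightarrow> complex)" where
  "TS S = dual_map (RS S) (\<lambda>r. 2 * r)"

text \<open>
  Topological entropy of a continuous self-map of a compact space, in the open-cover
  definition of Adler, Konheim and McAndrew. The limit defining the entropy of a cover
  exists by subadditivity, so it is written as a \<open>limsup\<close>.
\<close>

definition open_cover :: "'a topology \<Rightarrow> 'a set set \<Rightarrow> bool" where
  "open_cover Y U \<longleftrightarrow> (\<forall>u\<in>U. openin Y u) \<and> \<Union>U = topspace Y"

definition subcover_number :: "'a topology \<Rightarrow> 'a set set \<Rightarrow> nat" where
  "subcover_number Y U = (LEAST k. \<exists>V\<subseteq>U. finite V \<and> card V = k \<and> \<Union>V = topspace Y)"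

text \<open>The common refinement of the preimages of \<open>U\<close> under \<open>f\<^sup>0, \<dots>, f\<^sup>n\<^sup>-\<^sup>1\<close>.\<close>

definition iterated_cover :: "'a topology \<Rightarrow> ('a \<Rightarrow> 'a) \<Rightarrow> 'a set set \<Rightarrow> nat \<Rightarrow> 'a set set" where
  "iterated_cover Y f U n =
     {{x \<in> topspace Y. \<forall>i<n. (f ^^ i) x \<in> u i} | u. \<forall>i<n. u i \<in> U}"

definition cover_entropy :: "'a topology \<Rightarrow> ('a \<Rightarrow> 'a) \<Rightarrow> 'a set set \<Rightarrow> ereal" where
  "cover_entropy Y f U =
     limsup (\<lambda>n. ereal (ln (real (subcover_number Y (iterated_cover Y f U n))) / real n))"

definition topological_entropy :: "'a topology \<Rightarrow> ('a \<Rightarrow> 'a) \<Rightarrow> ereal" where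
  "topological_entropy Y f = (SUP U\<in>{U. open_cover Y U}. cover_entropy Y f U)"

text \<open>The length of a closed orbit is its cardinality; the condition \<open>card \<tau> = n\<close> says that \<open>n\<close>
is the least period of \<open>x\<close>.\<close>

definition closed_orbits :: "'a set \<Rightarrow> ('a \<Rightarrow> 'a) \<Rightarrow> 'a set set" where
  "closed_orbits Y f =
     {\<tau>. \<exists>x\<in>Y. \<exists>n\<ge>1. (f ^^ n) x = x \<and> \<tau> = (\<lambda>i. (f ^^ i) x) ` {0..n} \<and> card \<tau> = n}"

text \<open>The sum is over a finite set: a power \<open>TS S ^^ n\<close> with \<open>n \<ge> 1\<close> has at most \<open>2\<^sup>n - 1\<close>
fixed points. The entropy is finite, so \<^const>\<open>real_of_ereal\<close> only changes its type.\<close>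

definition MS :: "nat set \<Rightarrow> nat \<Rightarrow> real" where
  "MS S N =
     (\<Sum>\<tau> | \<tau> \<in> closed_orbits (topspace (dual_RS S)) (TS S) \<and> card \<tau> \<le> N.
        exp (- real_of_ereal (topological_entropy (dual_RS S) (TS S)) * real (card \<tau>)))"

end

theory Submission imports Defs "HOL-Real_Asymp.Real_Asymp" begin

text \<open>
  A character of \<open>RS S\<close> fixed by the \<open>n\<close>-th power of the map is trivial on the multiples of the
  part \<open>m'\<close> of \<open>2\<^sup>n - 1\<close> prime to \<open>S\<close>, hence determined by its value at \<open>1\<close>, an \<open>m'\<close>-th root of
  unity. As the entropy is \<open>ln 2\<close>, the counting function is at most the sum of \<open>m' / (n 2\<^sup>n)\<close>.

  For the set \<open>S\<close> of the theorem, \<open>m'\<close> involves only primes whose order is a prime \<open>q\<close> dividing \<open>n\<close>.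
  Lifting the exponent shows that \<open>m'\<close> divides \<open>n\<close> times the product of the \<open>2\<^sup>q - 1\<close>, which for
  composite \<open>n\<close> is at most \<open>4 n 2\<^sup>n\<^sup>/\<^sup>2\<close>. So composite \<open>n\<close> contribute \<open>O(1)\<close>, and prime \<open>n\<close>
  contribute at most the sum of the reciprocals of the primes, which is \<open>O(sqrt (ln N))\<close>.

  For the complement of \<open>S\<close>, the number \<open>m'\<close> is coprime to \<open>2\<^sup>q - 1\<close> for every prime \<open>q\<close> dividing
  \<open>n\<close>, so the \<open>n\<close>-th term is at most \<open>1 / (n Q)\<close> if \<open>n\<close> has a prime factor \<open>q \<ge> Q\<close>, while the
  sum of \<open>1 / n\<close> over the remaining \<open>n\<close> is bounded. Finally let \<open>Q\<close> tend to infinity.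
\<close>

section \<open>Prime factors of Mersenne numbers\<close>

text \<open>With \<open>y = 1 + p * t\<close>, only the linear term of \<open>y ^ j\<close> survives
  modulo the square of \<open>p\<close>, and the whole sum becomes congruent to \<open>p\<close>. So
  the cofactor of \<open>y - 1\<close> in \<open>y ^ p - 1\<close> has exactly one factor
  \<open>p\<close>.\<close>

lemma sum_powers_not_cong_0:
  fixes p :: nat and y :: int
  assumes "prime p" "odd p" "int p dvd y - 1"
  shows "\<not> int p ^ 2 dvd (\<Sum>j<p. y ^ j)"
proof -
  obtain t where t: "y = 1 + int p * t" using assms(3) by (metis dvdE diff_add_cancel add.commute)
  have c: "[y ^ j = 1 + int j * (int p * t)] (mod int p ^ 2)" for j
  proof (induction j)
    case (Suc j)
    have "[y ^ Suc j = (1 + int p * t) * (1 + int j * (int p * t))] (mod int p ^ 2)"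
      using Suc t by (simp add: cong_scalar_left)
    also have "(1 + int p * t) * (1 + int j * (int p * t)) = 1 + int (Suc j) * (int p * t) + int p ^ 2 * (int j * t^2)"
      by (simp add: algebra_simps power2_eq_square)
    also have "[\<dots> = 1 + int (Suc j) * (int p * t)] (mod int p ^ 2)"
      by (simp add: cong_iff_dvd_diff)
    finally show ?case .
  qed simp
  \<comment> \<open>Oddness enters here: the sum of all \<open>j < p\<close> equals
    \<open>k * p\<close>, again a multiple of \<open>p\<close>, which makes the linear terms
    vanish.\<close>
  obtain k where k: "p = 2 * k + 1" using assms(2) by (elim oddE)
  have g: "(\<Sum>j<2*k+1. int j) = int k * (2 * int k + 1)"
    by (induction k) (auto simp: algebra_simps)
  have "[(\<Sum>j<p. y ^ j) = (\<Sum>j<p. 1 + int j * (int p * t))] (mod int p ^ 2)"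
    by (intro cong_sum c)
  also have "(\<Sum>j<p. 1 + int j * (int p * t)) = int p + (\<Sum>j<p. int j) * (int p * t)"
    by (simp add: sum.distrib sum_distrib_right)
  also have "(\<Sum>j<p. int j) = int k * int p" using g k by simp
  also have "[int p + int k * int p * (int p * t) = int p] (mod int p ^ 2)"
    by (simp add: cong_iff_dvd_diff power2_eq_square)
  finally have *: "[(\<Sum>j<p. y ^ j) = int p] (mod int p ^ 2)" .
  show ?thesis
  proof
    assume "int p ^ 2 dvd (\<Sum>j<p. y ^ j)"
    with * have "int p ^ 2 dvd int p" by (meson cong_dvd_iff)
    then have "int p ^ 2 \<le> int p" using assms(1) by (intro zdvd_imp_le) (auto simp: prime_gt_0_nat)
    moreover have "int p > 1" using assms(1) prime_gt_1_nat by auto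
    ultimately show False by (simp add: power2_eq_square)
  qed
qed

text \<open>The upper bound in lifting the exponent, phrased as a divisibility so that
  \<open>x = 1\<close> is no exception. Induction on \<open>k\<close>: if \<open>p\<close> does not
  divide \<open>k\<close>, the cofactor is congruent to \<open>k\<close> and hence prime to
  \<open>p\<close>; otherwise one factor \<open>p\<close> of \<open>k\<close> is split off.\<close>

lemma prime_power_dvd_power_minus_one:
  fixes p k v :: nat and x :: int
  assumes "prime p" "odd p" "int p dvd x - 1" "k > 0" "int p ^ v dvd x ^ k - 1"
  shows "int p ^ v dvd int k * (x - 1)"
  using assms(4,5)
proof (induction k arbitrary: v rule: less_induct)
  case (less k)
  have pint: "prime (int p)" using assms(1) by simp
  have yl: "int p dvd x ^ l - 1" for l
    using assms(3) by (metis cong_iff_dvd_diff cong_pow power_one)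
  show ?case
  proof (cases "p dvd k")
    case False
    have "[(\<Sum>j<k. x ^ j) = (\<Sum>j<k. 1)] (mod int p)"
      by (intro cong_sum) (simp add: cong_iff_dvd_diff yl)
    then have "\<not> int p dvd (\<Sum>j<k. x ^ j)"
      using False by (simp add: cong_dvd_iff)
    then have "coprime (int p ^ v) (\<Sum>j<k. x ^ j)"
      using pint by (metis coprime_commute prime_imp_power_coprime)
    moreover have "int p ^ v dvd (x - 1) * (\<Sum>j<k. x ^ j)"
      using less.prems(2) by (simp add: power_diff_1_eq)
    ultimately show ?thesis by (simp add: coprime_dvd_mult_left_iff)
  next
    case True
    then obtain l where l: "k = p * l" by auto
    define y where "y = x ^ l"
    have lk: "l < k" "l > 0" using l less.prems(1) prime_gt_1_nat[OF assms(1)] by auto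
    show ?thesis
    proof (cases v)
      case (Suc w)
      have nd: "\<not> int p ^ 2 dvd (\<Sum>j<p. y ^ j)"
        using sum_powers_not_cong_0[OF assms(1,2)] yl y_def by blast
      have "[(\<Sum>j<p. y ^ j) = (\<Sum>j<p. 1)] (mod int p)"
        using yl by (intro cong_sum) (simp add: cong_iff_dvd_diff y_def flip: power_mult)
      then have "int p dvd (\<Sum>j<p. y ^ j)"
        by (simp add: cong_dvd_iff)
      then obtain c where c: "(\<Sum>j<p. y ^ j) = int p * c" by auto
      have "\<not> int p dvd c" using nd c by (auto simp: power2_eq_square)
      then have cop: "coprime (int p ^ w) c" using pint by (metis coprime_commute prime_imp_power_coprime)
      \<comment> \<open>The cofactor contributes exactly one factor \<open>p\<close>, which is
        cancelled before the induction hypothesis is applied to \<open>l\<close>.\<close>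
      have "int p * int p ^ w dvd y ^ p - 1"
        using less.prems(2) Suc l by (simp add: y_def power_mult[symmetric] mult.commute)
      also have "y ^ p - 1 = int p * (c * (y - 1))"
        using c by (simp add: power_diff_1_eq)
      finally have "int p ^ w dvd c * (y - 1)" using pint by simp
      then have "int p ^ w dvd y - 1" using cop by (simp add: coprime_dvd_mult_right_iff)
      then have "int p ^ w dvd int l * (x - 1)"
        using less.IH[OF lk] by (simp add: y_def)
      then show ?thesis using l Suc by (simp add: mult.assoc)
    qed simp
  qed
qed

section \<open>The part of an integer prime to a set of primes\<close>

text \<open>For \<open>m > 0\<close> this is \<open>m\<close> times the product of its
  \<open>p\<close>-adic absolute values over the primes in \<open>S\<close>. At
  \<open>m = 2 ^ n - 1\<close> it is the known number of points fixed by the \<open>n\<close>-th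
  iterate.\<close>

definition coprime_part :: "nat set \<Rightarrow> nat \<Rightarrow> nat" where
  "coprime_part S m = (\<Prod>p\<in>prime_factors m - S. p ^ multiplicity p m)"

lemma coprime_part_pos: "coprime_part S m > 0"
  unfolding coprime_part_def by (intro prod_pos) (auto simp: prime_gt_0_nat in_prime_factors_imp_prime)

lemma prime_dvd_coprime_part:
  assumes "prime p" "p dvd coprime_part S m"
  shows "p dvd m" "p \<notin> S"
proof -
  obtain q where "q \<in> prime_factors m - S" "p dvd q ^ multiplicity q m"
    using assms unfolding coprime_part_def by (meson finite_Diff finite_set_mset prime_dvd_prod_iff)
  then have "p = q" using assms(1)
    by (metis DiffD1 in_prime_factors_imp_prime prime_dvd_power primes_dvd_imp_eq)
  then show "p dvd m" "p \<notin> S" using \<open>q \<in> _\<close> by auto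
qed

lemma coprime_part_decomp:
  assumes "m > 0"
  obtains s where "m = s * coprime_part S m" "\<And>p. prime p \<Longrightarrow> p dvd s \<Longrightarrow> p \<in> S"
proof
  let ?s = "\<Prod>p\<in>prime_factors m \<inter> S. p ^ multiplicity p m"
  have "m = (\<Prod>p\<in>prime_factors m. p ^ multiplicity p m)"
    using assms prime_factorization_nat by blast
  also have "prime_factors m = (prime_factors m \<inter> S) \<union> (prime_factors m - S)" by auto
  also have "(\<Prod>p\<in>\<dots>. p ^ multiplicity p m) = ?s * coprime_part S m"
    unfolding coprime_part_def by (intro prod.union_disjoint) auto
  finally show "m = ?s * coprime_part S m" .
  show "p \<in> S" if p: "prime p" "p dvd ?s" for p
  proof -
    obtain q where "q \<in> prime_factors m \<inter> S" "p dvd q ^ multiplicity q m"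
      using p by (auto simp: prime_dvd_prod_iff)
    then show ?thesis using p(1)
      by (metis IntD1 IntD2 in_prime_factors_imp_prime prime_dvd_power primes_dvd_imp_eq)
  qed
qed

lemma coprime_part_dvd: "m > 0 \<Longrightarrow> coprime_part S m dvd m"
  using coprime_part_decomp by (metis dvd_triv_right)

lemma coprime_part_dvdI:
  assumes "\<And>p. p \<in> prime_factors m - S \<Longrightarrow> p ^ multiplicity p m dvd a"
  shows "coprime_part S m dvd a"
proof -
  \<comment> \<open>Divisibility is read as congruence to 0, so that the pairwise coprime prime
    powers can be combined.\<close>
  have "[a = 0] (mod (\<Prod>p\<in>prime_factors m - S. p ^ multiplicity p m))"
    using assms by (intro coprime_cong_prod_nat)
      (auto simp: cong_0_iff in_prime_factors_imp_prime primes_coprime)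
  then show ?thesis by (simp add: coprime_part_def cong_0_iff)
qed

section \<open>Sums of distinct prime factors\<close>

lemma composite_nat_factors:
  fixes n :: nat
  assumes "n > 1" "\<not> prime n"
  obtains a b where "n = (a + 2) * (b + 2)"
proof -
  obtain q where q: "prime q" "q dvd n" using assms(1) by (metis less_irrefl prime_factor_nat)
  then obtain k where k: "n = q * k" by auto
  have "k \<noteq> 0" "k \<noteq> 1" using assms q k by auto
  then have "k \<ge> 2" by linarith
  moreover have "q \<ge> 2" using q prime_ge_2_nat by blast
  ultimately have "n = (q - 2 + 2) * (k - 2 + 2)" using k by (simp only: le_add_diff_inverse2)
  then show ?thesis using that by blast
qed

lemma sum_prime_factors_mult_le:
  fixes a b :: nat
  assumes "a > 0" "b > 0"
  shows "\<Sum>(prime_factors (a * b)) \<le> \<Sum>(prime_factors a) + \<Sum>(prime_factors b)"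
  using assms by (simp add: prime_factorization_mult prime_factors_product sum_Un_nat)

text \<open>For a product of \<open>x\<close> and \<open>y\<close>, both at least 2, the induction
  closes because \<open>x + y \<le> x * y\<close>.\<close>

lemma sum_prime_factors_le: "n > 0 \<Longrightarrow> \<Sum>(prime_factors n) \<le> n" for n :: nat
proof (induction n rule: less_induct)
  case (less n)
  consider "n = 1" | "prime n" | "n > 1" "\<not> prime n" using less.prems by linarith
  then show ?case
  proof cases
    case 3
    then obtain a b where ab: "n = (a + 2) * (b + 2)"
      using composite_nat_factors by blast
    then have less_n: "a + 2 < n" "b + 2 < n" by simp_all
    have "\<Sum>(prime_factors n) \<le> \<Sum>(prime_factors (a + 2)) + \<Sum>(prime_factors (b + 2))"
      unfolding ab by (rule sum_prime_factors_mult_le) simp_all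
    also have "\<dots> \<le> (a + 2) + (b + 2)" using less_n less.IH by (intro add_mono) auto
    also have "\<dots> \<le> n" using ab by simp
    finally show ?thesis .
  qed (auto simp: prime_prime_factors)
qed

text \<open>With both factors \<open>x\<close> and \<open>y\<close> at least 2, the inequality
  \<open>2 * (x + y) \<le> x * y + 4\<close> says that \<open>(x - 2) * (y - 2)\<close> is
  nonnegative. The saved factor 2 is what makes the terms at composite indices summable.\<close>

lemma sum_prime_factors_composite_le:
  fixes n :: nat
  assumes "n > 1" "\<not> prime n"
  shows "2 * \<Sum>(prime_factors n) \<le> n + 4"
proof -
  obtain a b where ab: "n = (a + 2) * (b + 2)"
    using assms composite_nat_factors by blast
  have "\<Sum>(prime_factors n) \<le> \<Sum>(prime_factors (a + 2)) + \<Sum>(prime_factors (b + 2))"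
    unfolding ab by (rule sum_prime_factors_mult_le) simp_all
  also have "\<dots> \<le> (a + 2) + (b + 2)" using sum_prime_factors_le by (intro add_mono) auto
  finally have "2 * \<Sum>(prime_factors n) \<le> 2 * a + 2 * b + 8" by simp
  also have "\<dots> \<le> n + 4" using ab by simp
  finally show ?thesis .
qed

section \<open>Bounds for the relevant part of \<open>2 ^ n - 1\<close>\<close>

lemma two_power_minus_one_pos: "n > 0 \<Longrightarrow> (2::nat) ^ n - 1 > 0"
  by (metis one_less_numeral_iff one_less_power semiring_norm(76) zero_less_diff)

lemma odd_prime_dvd_two_power_minus_one:
  fixes p :: nat
  assumes "prime p" "p dvd 2 ^ n - 1" "n > 0"
  shows "odd p" "ord p 2 dvd n" "ord p 2 > 1"
proof -
  show "odd p"
  proof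
    assume "even p"
    then have "even ((2::nat) ^ n - 1)" using assms(2) by (rule dvd_trans)
    then show False using assms(3) by simp
  qed
  have "[2 ^ n = 1] (mod p)"
    using assms(2) by (metis cong_altdef_nat one_le_numeral one_le_power)
  then show dvd: "ord p 2 dvd n" by (simp only: ord_divides)
  \<comment> \<open>The value 0 is the convention for an undefined order; it is excluded because 0
    does not divide \<open>n > 0\<close>.\<close>
  have "ord p 2 \<noteq> 0" using dvd assms(3) by (metis dvd_0_left_iff less_irrefl)
  moreover have "ord p 2 \<noteq> 1"
  proof
    assume "ord p 2 = 1"
    then have "ord p 2 dvd 1" by (simp only: dvd_refl)
    then have "[2 ^ 1 = 1] (mod p)" by (simp only: ord_divides)
    then have "p dvd 2 - 1" by (subst (asm) cong_altdef_nat) auto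
    then show False using assms(1) by simp
  qed
  ultimately show "ord p 2 > 1" by linarith
qed

text \<open>Checked one prime power at a time: a prime \<open>p\<close> outside \<open>S\<close> has
  prime order \<open>q\<close> dividing \<open>n\<close>, so \<open>p\<close> divides
  \<open>2 ^ q - 1\<close>, and lifting the exponent from \<open>2 ^ q\<close> to its power
  \<open>n / q\<close> costs at most the factor \<open>n / q\<close>.\<close>

lemma coprime_part_mersenne_dvd:
  assumes "\<And>p. prime p \<Longrightarrow> odd p \<Longrightarrow> ord p 2 > 1 \<Longrightarrow> p \<notin> S \<Longrightarrow> prime (ord p 2)" and "n > 0"
  shows "coprime_part S (2 ^ n - 1) dvd n * (\<Prod>q\<in>prime_factors n. 2 ^ q - 1)"
proof (rule coprime_part_dvdI)
  fix p assume p: "p \<in> prime_factors (2 ^ n - 1) - S"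
  define v where "v = multiplicity p (2 ^ n - 1)"
  have pp: "prime p" "p dvd 2 ^ n - 1" using p by auto
  note o = odd_prime_dvd_two_power_minus_one[OF pp assms(2)]
  define q where "q = ord p 2"
  have q: "prime q" "q \<in> prime_factors n"
    using assms p pp o by (auto simp: q_def prime_factors_dvd)
  obtain k where k: "n = q * k" using o(2) q_def by blast
  have "p dvd 2 ^ q - 1"
    using ord[of 2 p] by (metis cong_altdef_nat one_le_numeral one_le_power q_def)
  then have "int p dvd 2 ^ q - 1"
    by (metis int_dvd_int_iff of_nat_1 of_nat_diff of_nat_numeral of_nat_power one_le_numeral one_le_power)
  moreover have "int p ^ v dvd (2 ^ q) ^ k - 1"
  proof -
    have "p ^ v dvd 2 ^ n - 1" by (simp add: v_def multiplicity_dvd)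
    then have "int (p ^ v) dvd int (2 ^ n - 1)" by (simp only: int_dvd_int_iff)
    then show ?thesis by (simp add: k power_mult)
  qed
  ultimately have "int p ^ v dvd int k * (2 ^ q - 1)"
    using pp o k assms(2) by (intro prime_power_dvd_power_minus_one) auto
  also have "\<dots> = int (k * (2 ^ q - 1))" by simp
  finally have "p ^ v dvd k * (2 ^ q - 1)" by (simp only: of_nat_power[symmetric] int_dvd_int_iff)
  also have "\<dots> dvd n * (\<Prod>q\<in>prime_factors n. 2 ^ q - 1)"
    using q k by (intro mult_dvd_mono) auto
  finally show "p ^ multiplicity p (2 ^ n - 1) dvd n * (\<Prod>q\<in>prime_factors n. 2 ^ q - 1)"
    by (simp add: v_def)
qed

lemma coprime_part_mersenne_le:
  assumes "\<And>p. prime p \<Longrightarrow> odd p \<Longrightarrow> ord p 2 > 1 \<Longrightarrow> p \<notin> S \<Longrightarrow> prime (ord p 2)"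
    and "n > 1" "\<not> prime n"
  shows "real (coprime_part S (2 ^ n - 1)) \<le> real n * (4 * sqrt 2 ^ n)"
proof -
  define s where "s = \<Sum>(prime_factors n)"
  have "coprime_part S (2 ^ n - 1) \<le> n * (\<Prod>q\<in>prime_factors n. 2 ^ q - 1)"
    using assms coprime_part_mersenne_dvd[of S n]
    by (intro dvd_imp_le mult_pos_pos prod_pos two_power_minus_one_pos)
      (auto simp: prime_gt_0_nat in_prime_factors_imp_prime)
  also have "\<dots> \<le> n * (\<Prod>q\<in>prime_factors n. 2 ^ q)"
    by (intro mult_left_mono prod_mono) auto
  also have "(\<Prod>q\<in>prime_factors n. 2 ^ q) = (2::nat) ^ s"
    by (simp add: s_def power_sum)
  finally have "real (coprime_part S (2 ^ n - 1)) \<le> real (n * 2 ^ s)"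
    by (simp only: of_nat_le_iff)
  also have "\<dots> = real n * 2 ^ s" by simp
  also have "(2::real) ^ s \<le> 4 * sqrt 2 ^ n"
  proof (rule power2_le_imp_le)
    \<comment> \<open>Comparing squares keeps all exponents natural: the bound is 2 to the power
      \<open>n / 2 + 2\<close>, the largest value allowed for \<open>s\<close>.\<close>
    have "((2::real) ^ s)\<^sup>2 = 2 ^ (2 * s)" by (metis power_mult mult.commute)
    also have "\<dots> \<le> 2 ^ (n + 4)"
      using sum_prime_factors_composite_le[OF assms(2,3)] by (intro power_increasing) (auto simp: s_def)
    also have "\<dots> = 16 * (sqrt 2 ^ n)\<^sup>2"
      by (simp add: power_add power2_eq_square flip: power_mult_distrib)
    also have "\<dots> = (4 * sqrt 2 ^ n)\<^sup>2"
      by (simp add: power_mult_distrib)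
    finally show "((2::real) ^ s)\<^sup>2 \<le> (4 * sqrt 2 ^ n)\<^sup>2" .
  qed simp
  finally show ?thesis by (simp add: mult_left_mono)
qed

text \<open>Every prime divisor of \<open>2 ^ q - 1\<close> has order \<open>q\<close>, which is
  prime, so it lies in \<open>S\<close>. Both factors therefore divide \<open>2 ^ n - 1\<close> and
  are coprime.\<close>

lemma coprime_part_mersenne_mult_dvd:
  assumes "\<And>p. prime p \<Longrightarrow> odd p \<Longrightarrow> prime (ord p 2) \<Longrightarrow> p \<in> S" and "n > 0" "prime q" "q dvd n"
  shows "coprime_part S (2 ^ n - 1) * (2 ^ q - 1) dvd 2 ^ n - 1"
proof (rule divides_mult)
  have pos: "(2::nat) ^ n - 1 > 0" using assms(2) by (rule two_power_minus_one_pos)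
  then show "coprime_part S (2 ^ n - 1) dvd 2 ^ n - 1" by (rule coprime_part_dvd)
  obtain k where k: "n = q * k" using assms(4) by auto
  have "((2::int) ^ q) - 1 dvd (2 ^ q) ^ k - 1" by (simp add: power_diff_1_eq)
  then have "int (2 ^ q - 1) dvd int (2 ^ n - 1)" by (simp add: k power_mult)
  then show "(2::nat) ^ q - 1 dvd 2 ^ n - 1" by (simp only: int_dvd_int_iff)
  show "coprime (coprime_part S (2 ^ n - 1)) (2 ^ q - 1)"
  proof (rule ccontr)
    assume "\<not> ?thesis"
    then have "gcd (coprime_part S (2 ^ n - 1)) (2 ^ q - 1) \<noteq> 1"
      by (simp only: coprime_iff_gcd_eq_1 not_False_eq_True)
    then obtain p where "prime p" "p dvd gcd (coprime_part S (2 ^ n - 1)) (2 ^ q - 1)"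
      using prime_factor_nat by blast
    then have p: "prime p" "p dvd coprime_part S (2 ^ n - 1)" "p dvd 2 ^ q - 1"
      by (simp_all only: gcd_greatest_iff)
    note o = odd_prime_dvd_two_power_minus_one[OF p(1,3) prime_gt_0_nat[OF assms(3)]]
    \<comment> \<open>The order divides the prime \<open>q\<close> and exceeds 1.\<close>
    then have "ord p 2 = q" using assms(3) by (metis less_irrefl prime_nat_iff)
    then have "p \<in> S" using assms(1,3) p o by blast
    then show False using prime_dvd_coprime_part p by blast
  qed
qed

section \<open>Sums of reciprocals\<close>

text \<open>Expanding the square gives a sum over pairs of primes; each product is at most the
  square of \<open>N\<close> and arises from at most two pairs. This elementary bound of order
  \<open>sqrt (ln N)\<close> is already smaller than \<open>ln N\<close>.\<close>

lemma sum_prime_reciprocals_sq_le: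
  "(\<Sum>p | prime p \<and> p \<le> N. 1 / real p)\<^sup>2 \<le> 2 * harm (N\<^sup>2)"
proof -
  let ?P = "{p. prime p \<and> p \<le> N}"
  have fin: "finite ?P" by simp
  \<comment> \<open>By unique factorization an ordered pair of primes is determined by its product.\<close>
  define L where "L = {(p, q). p \<in> ?P \<and> q \<in> ?P \<and> p \<le> q}"
  have finL: "finite L" by (rule finite_subset[of _ "?P \<times> ?P"]) (auto simp: L_def)
  let ?f = "\<lambda>(p, q). 1 / real (p * q)"
  have inj: "inj_on (\<lambda>(p, q). p * q) L"
  proof (rule inj_onI, clarify)
    fix p q p' q' assume "(p, q) \<in> L" "(p', q') \<in> L" and eq: "p * q = p' * q'"
    then have pr: "prime p" "prime q" "prime p'" "prime q'" "p \<le> q" "p' \<le> q'"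
      by (auto simp: L_def)
    then have "prime_factorization (p * q) = {#p, q#}" "prime_factorization (p' * q') = {#p', q'#}"
      by (auto simp: prime_factorization_mult prime_factorization_prime)
    then have "{#p, q#} = {#p', q'#}" using eq by simp
    then show "p = p' \<and> q = q'" using pr by (auto simp: add_eq_conv_ex)
  qed
  have "sum ?f L = (\<Sum>n\<in>(\<lambda>(p, q). p * q) ` L. 1 / real n)"
    by (subst sum.reindex[OF inj]) (auto intro: sum.cong)
  also have "\<dots> \<le> (\<Sum>n\<in>{1..N\<^sup>2}. 1 / real n)"
    by (intro sum_mono2) (auto simp: L_def power2_eq_square prime_gt_0_nat Suc_le_eq mult_le_mono)
  also have "\<dots> = harm (N\<^sup>2)" by (simp add: harm_def field_simps)
  finally have L: "sum ?f L \<le> harm (N\<^sup>2)" .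
  have "(\<Sum>p\<in>?P. 1 / real p)\<^sup>2 = sum ?f (?P \<times> ?P)"
    by (simp add: power2_eq_square sum_product sum.cartesian_product)
  \<comment> \<open>The pairs in the other order are the mirror image of \<open>L\<close>; the
    diagonal is covered twice, which only weakens the bound.\<close>
  also have "?P \<times> ?P = L \<union> prod.swap ` L" by (auto simp: L_def image_iff)
  also have "sum ?f \<dots> \<le> sum ?f L + sum ?f (prod.swap ` L)"
    using finL by (subst sum_Un) (auto intro!: sum_nonneg)
  also have "sum ?f (prod.swap ` L) = sum ?f L"
    by (subst sum.reindex) (auto intro!: sum.cong simp: mult.commute)
  finally show ?thesis using L by simp
qed

text \<open>The cutoff \<open>N\<close> makes every sum finite, so that the Euler product can be
  estimated without convergence questions.\<close>

definition smooth_upto :: "nat set \<Rightarrow> nat \<Rightarrow> nat set" where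
  "smooth_upto P N = {n \<in> {1..N}. prime_factors n \<subseteq> P}"

lemma finite_smooth_upto [simp]: "finite (smooth_upto P N)"
  by (simp add: smooth_upto_def)

text \<open>An Euler product in which each factor is at most 2. When \<open>q\<close> joins
  \<open>P\<close>, an index either avoids \<open>q\<close> or is \<open>q\<close> times another
  index, so the new sum is at most the old one plus half of itself.\<close>

lemma sum_smooth_reciprocals_le:
  assumes "finite P" "\<And>p. p \<in> P \<Longrightarrow> prime p"
  shows "(\<Sum>n\<in>smooth_upto P N. 1 / real n) \<le> 2 ^ card P"
  using assms
proof (induction P rule: finite_induct)
  case empty
  have "smooth_upto {} N \<subseteq> {1}" by (auto simp: smooth_upto_def prime_factorization_empty_iff)
  then have "(\<Sum>n\<in>smooth_upto {} N. 1 / real n) \<le> (\<Sum>n\<in>{1}. 1 / real n)"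
    by (intro sum_mono2) auto
  then show ?case by simp
next
  case (insert q P)
  let ?g = "\<lambda>P. \<Sum>n\<in>smooth_upto P N. 1 / real n"
  have q: "q \<ge> 2" using insert.prems prime_ge_2_nat by auto
  have "smooth_upto (insert q P) N \<subseteq> smooth_upto P N \<union> (*) q ` smooth_upto (insert q P) N"
  proof
    fix n assume n: "n \<in> smooth_upto (insert q P) N"
    show "n \<in> smooth_upto P N \<union> (*) q ` smooth_upto (insert q P) N"
    proof (cases "q dvd n")
      case True
      then obtain k where k: "n = q * k" by auto
      then have "k > 0" using n by (auto simp: smooth_upto_def intro: Nat.gr0I)
      moreover have "prime_factors k \<subseteq> prime_factors n"
        using k n by (intro dvd_prime_factors) (auto simp: smooth_upto_def)
      moreover have "k \<le> n" using k q by simp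
      ultimately have "k \<in> smooth_upto (insert q P) N" using n by (auto simp: smooth_upto_def)
      then show ?thesis using k by blast
    next
      case False
      then show ?thesis using n by (auto simp: smooth_upto_def)
    qed
  qed
  then have "?g (insert q P) \<le> (\<Sum>n\<in>smooth_upto P N \<union> (*) q ` smooth_upto (insert q P) N. 1 / real n)"
    by (intro sum_mono2) auto
  also have "\<dots> \<le> ?g P + (\<Sum>n\<in>(*) q ` smooth_upto (insert q P) N. 1 / real n)"
    by (subst sum_Un) (auto intro!: sum_nonneg)
  also have "(\<Sum>n\<in>(*) q ` smooth_upto (insert q P) N. 1 / real n) = ?g (insert q P) / real q"
    using q by (subst sum.reindex) (auto simp: inj_on_def sum_divide_distrib mult.commute)
  also have "\<dots> \<le> ?g (insert q P) / 2"
    using q by (intro divide_left_mono) (auto intro!: sum_nonneg)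
  finally have "?g (insert q P) \<le> 2 * ?g P" by simp
  also have "\<dots> \<le> 2 ^ card (insert q P)" using insert by simp
  finally show ?case .
qed

section \<open>The ring and its characters\<close>

text \<open>The fraction is in lowest terms, so a prime in the denominator is absent from the
  numerator and nothing can cancel its contribution.\<close>

lemma padic_abs_le_1_iff:
  assumes "prime p"
  shows "padic_abs p r \<le> 1 \<longleftrightarrow> \<not> int p dvd snd (quotient_of r)"
proof (cases "r = 0")
  case True
  then show ?thesis using assms prime_gt_1_nat[OF assms] by (simp add: padic_abs_def)
next
  case False
  obtain a b where ab: "quotient_of r = (a, b)" by fastforce
  have b: "b > 0" "coprime a b" using ab quotient_of_denom_pos quotient_of_coprime by auto
  have p: "real p > 1" "prime_elem (int p)" using assms prime_gt_1_nat by auto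
  show ?thesis
  proof (cases "int p dvd b")
    case True
    then have "\<not> int p dvd a" using b p coprime_common_divisor[of a b "int p"] by auto
    then have "multiplicity (int p) a = 0" by (rule not_dvd_imp_multiplicity_0)
    moreover have "multiplicity (int p) b > 0"
      using True b assms by (simp add: prime_multiplicity_gt_zero_iff)
    then have "real p ^ multiplicity (int p) b > 1" using p by (intro one_less_power) auto
    ultimately show ?thesis using True False ab by (simp add: padic_abs_def)
  next
    case nd: False
    then have "multiplicity (int p) b = 0" by (rule not_dvd_imp_multiplicity_0)
    then show ?thesis using nd False ab p
      by (simp add: padic_abs_def power_int_minus inverse_le_1_iff)
  qed
qed

lemma RS_iff: "r \<in> RS S \<longleftrightarrow> (\<forall>p. prime p \<and> int p dvd snd (quotient_of r) \<longrightarrow> p \<in> S)"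
  unfolding RS_def using padic_abs_le_1_iff by blast

text \<open>The fraction need not be reduced: its reduced denominator divides \<open>b\<close> and
  so has no other primes.\<close>

lemma RS_divideI:
  assumes "b > 0" "\<And>p. prime p \<Longrightarrow> p dvd b \<Longrightarrow> p \<in> S"
  shows "of_int a / of_nat b \<in> RS S"
proof -
  obtain c d where cd: "quotient_of (of_int a / of_nat b) = (c, d)" by fastforce
  have d: "d > 0" "coprime c d" using cd quotient_of_denom_pos quotient_of_coprime by auto
  have "of_int a / of_nat b = (of_int c / of_int d :: rat)" using cd by (rule quotient_of_div)
  then have "of_int (a * d) = (of_int (c * int b) :: rat)" using assms(1) d by (simp add: field_simps)
  then have "a * d = c * int b" by (simp only: of_int_eq_iff)
  then have "d dvd c * int b" by (metis dvd_triv_right)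
  then have "d dvd int b" using d by (simp add: coprime_commute coprime_dvd_mult_right_iff)
  then show ?thesis unfolding RS_iff using cd assms(2) by (auto dest: dvd_trans)
qed

lemma RS_cases:
  assumes "r \<in> RS S"
  obtains a b where "r = of_int a / of_nat b" "b > 0" "\<And>p. prime p \<Longrightarrow> p dvd b \<Longrightarrow> p \<in> S"
proof -
  obtain a d where ad: "quotient_of r = (a, d)" by fastforce
  have d: "d > 0" using ad quotient_of_denom_pos by auto
  show ?thesis
  proof
    show "r = of_int a / of_nat (nat d)" using quotient_of_div[OF ad] d by simp
    show "nat d > 0" using d by simp
    show "p \<in> S" if "prime p" "p dvd nat d" for p
      using that assms ad d unfolding RS_iff by (metis int_dvd_int_iff int_nat_eq order_less_imp_le snd_conv)
  qed
qed

lemma RS_add: "r \<in> RS S \<Longrightarrow> s \<in> RS S \<Longrightarrow> r + s \<in> RS S"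
proof (elim RS_cases)
  fix a b c d
  assume "r = of_int a / of_nat b" "b > 0" "\<And>p. prime p \<Longrightarrow> p dvd b \<Longrightarrow> p \<in> S"
    "s = of_int c / of_nat d" "d > 0" "\<And>p. prime p \<Longrightarrow> p dvd d \<Longrightarrow> p \<in> S"
  then have "of_int (a * int d + c * int b) / of_nat (b * d) \<in> RS S"
    by (intro RS_divideI) (auto simp: prime_dvd_mult_iff)
  also have "of_int (a * int d + c * int b) / of_nat (b * d) = r + s"
    using \<open>b > 0\<close> \<open>d > 0\<close> \<open>r = _\<close> \<open>s = _\<close> by (simp add: field_simps)
  finally show "r + s \<in> RS S" .
qed

lemma RS_of_int_mult: "r \<in> RS S \<Longrightarrow> of_int k * r \<in> RS S"
proof (elim RS_cases)
  fix a b
  assume "r = of_int a / of_nat b" "b > 0" "\<And>p. prime p \<Longrightarrow> p dvd b \<Longrightarrow> p \<in> S"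
  then show "of_int k * r \<in> RS S" using RS_divideI[of b S "k * a"] by simp
qed

lemma RS_divide_of_nat:
  assumes "r \<in> RS S" "s > 0" "\<And>p. prime p \<Longrightarrow> p dvd s \<Longrightarrow> p \<in> S"
  shows "r / of_nat s \<in> RS S"
  using assms(1)
proof (elim RS_cases)
  fix a b
  assume "r = of_int a / of_nat b" "b > 0" "\<And>p. prime p \<Longrightarrow> p dvd b \<Longrightarrow> p \<in> S"
  then show "r / of_nat s \<in> RS S"
    using RS_divideI[of "b * s" S a] assms(2,3) by (auto simp: prime_dvd_mult_iff)
qed

lemma RS_1: "1 \<in> RS S"
  using RS_divideI[of 1 S 1] by simp

text \<open>Finitely many rationals lie in a cyclic group, generated by the reciprocal of a common
  denominator, whose primes are still in \<open>S\<close>. This lets a single coordinate of a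
  character control finitely many others.\<close>

lemma RS_common_generator:
  assumes "finite F" "F \<subseteq> RS S"
  obtains g where "g \<in> RS S" "\<And>r. r \<in> F \<Longrightarrow> \<exists>k::int. r = of_int k * g"
proof -
  have "\<exists>g\<in>RS S. \<forall>r\<in>F. \<exists>k::int. r = of_int k * g"
    using assms
  proof (induction F rule: finite_induct)
    case empty
    then show ?case using RS_1 by auto
  next
    case (insert r F)
    then obtain g where g: "g \<in> RS S" "\<forall>r\<in>F. \<exists>k::int. r = of_int k * g" by auto
    from insert.prems have "r \<in> RS S" by simp
    then obtain a b where ab: "r = of_int a / of_nat b" "b > 0" "\<And>p. prime p \<Longrightarrow> p dvd b \<Longrightarrow> p \<in> S"
      by (rule RS_cases) blast
    from g(1) obtain c d where cd: "g = of_int c / of_nat d" "d > 0" "\<And>p. prime p \<Longrightarrow> p dvd d \<Longrightarrow> p \<in> S"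
      by (rule RS_cases) blast
    define e :: rat where "e = of_int 1 / of_nat (b * d)"
    have "e \<in> RS S" unfolding e_def
      using ab cd by (intro RS_divideI) (auto simp: prime_dvd_mult_iff)
    moreover have r: "r = of_int (a * int d) * e" using ab cd by (simp add: e_def)
    moreover have "g = of_int (c * int b) * e" using ab cd by (simp add: e_def)
    then have "\<exists>k::int. x = of_int k * e" if "x \<in> F" for x
      using g(2) that by (metis mult.assoc of_int_mult)
    ultimately show ?case by blast
  qed
  then show ?thesis using that by blast
qed

section \<open>Characters and the dual of doubling\<close>

lemma characters_add:
  "\<psi> \<in> characters A \<Longrightarrow> r \<in> A \<Longrightarrow> s \<in> A \<Longrightarrow> \<psi> (r + s) = \<psi> r * \<psi> s"
  by (simp add: characters_def)

lemma characters_norm: "\<psi> \<in> characters A \<Longrightarrow> r \<in> A \<Longrightarrow> norm (\<psi> r) = 1"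
  by (auto simp: characters_def PiE_iff)

lemma characters_RS_of_int_mult:
  assumes "\<psi> \<in> characters (RS S)" "r \<in> RS S"
  shows "\<psi> (of_int k * r) = \<psi> r powi k"
proof -
  note mem = RS_of_int_mult[OF assms(2)]
  have nz: "\<psi> s \<noteq> 0" if "s \<in> RS S" for s
    using characters_norm[OF assms(1) that] by auto
  have z: "0 \<in> RS S" using mem[of 0] by simp
  have "\<psi> (0 + 0) = \<psi> 0 * \<psi> 0" using assms z by (intro characters_add)
  then have zero: "\<psi> 0 = 1" using nz[OF z] by simp
  have nat: "\<psi> (of_int (int n) * r) = \<psi> r ^ n" for n
  proof (induction n)
    case (Suc n)
    have "of_int (int (Suc n)) * r = r + of_int (int n) * r" by (simp add: algebra_simps)
    then show ?case using Suc assms mem by (simp only: characters_add power_Suc)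
  qed (simp add: zero)
  show ?thesis
  proof (cases k)
    case (nonneg n)
    then show ?thesis using nat by (simp del: of_int_of_nat_eq)
  next
    case (neg n)
    define j where "j = int (Suc n)"
    have "\<psi> (of_int k * r + of_int j * r) = \<psi> (of_int k * r) * \<psi> (of_int j * r)"
      using assms mem by (intro characters_add)
    also have "of_int k * r + of_int j * r = of_int (k + j) * r" by (simp add: distrib_right)
    also have "\<dots> = 0" using neg by (simp add: j_def)
    also have "\<psi> (of_int j * r) = \<psi> r ^ Suc n" unfolding j_def by (rule nat)
    finally have "\<psi> (of_int k * r) * \<psi> r ^ Suc n = 1" using zero by simp
    then have "\<psi> (of_int k * r) = inverse (\<psi> r ^ Suc n)"
      by (metis inverse_unique mult.commute)
    also have "\<dots> = \<psi> r powi k" by (simp only: neg power_int_minus power_int_of_nat)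
    finally show ?thesis .
  qed
qed

lemma topspace_dual_RS: "topspace (dual_RS S) = characters (RS S)"
proof -
  have "characters (RS S) \<subseteq> (\<Pi>\<^sub>E r\<in>RS S. UNIV)" unfolding characters_def by blast
  then show ?thesis by (auto simp: dual_RS_def dual_topology_def)
qed

lemma TS_apply: "r \<in> RS S \<Longrightarrow> TS S \<psi> r = \<psi> (2 * r)"
  by (simp add: TS_def dual_map_def)

lemma RS_2_mult: "r \<in> RS S \<Longrightarrow> 2 * r \<in> RS S"
  using RS_of_int_mult[of r S 2] by simp

lemma TS_in_characters:
  assumes "\<psi> \<in> characters (RS S)"
  shows "TS S \<psi> \<in> characters (RS S)"
proof -
  have "TS S \<psi> \<in> RS S \<rightarrow>\<^sub>E sphere 0 1"
    using assms by (auto simp: TS_def dual_map_def RS_2_mult characters_norm)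
  then show ?thesis
    using assms by (auto simp: characters_def TS_apply RS_add RS_2_mult distrib_left)
qed

lemma funpow_TS_in_characters: "\<psi> \<in> characters (RS S) \<Longrightarrow> (TS S ^^ n) \<psi> \<in> characters (RS S)"
  by (induction n) (auto intro: TS_in_characters)

lemma funpow_TS_apply: "r \<in> RS S \<Longrightarrow> (TS S ^^ n) \<psi> r = \<psi> (2 ^ n * r)"
proof (induction n arbitrary: r)
  case (Suc n)
  then have "(TS S ^^ Suc n) \<psi> r = \<psi> (2 ^ n * (2 * r))" by (simp add: TS_apply RS_2_mult)
  then show ?case by (simp add: mult.assoc mult.left_commute)
qed simp

lemma funpow_TS_apply_power:
  assumes "\<psi> \<in> characters (RS S)" "r \<in> RS S"
  shows "(TS S ^^ n) \<psi> r = \<psi> r ^ (2 ^ n)"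
proof -
  have "(TS S ^^ n) \<psi> r = \<psi> (of_int (int (2 ^ n)) * r)"
    using assms(2) by (simp add: funpow_TS_apply)
  also have "\<dots> = \<psi> r powi int (2 ^ n)" using assms by (rule characters_RS_of_int_mult)
  also have "\<dots> = \<psi> r ^ (2 ^ n)" by (simp only: power_int_of_nat)
  finally show ?thesis .
qed

section \<open>Periodic points and closed orbits\<close>

definition periodic_points :: "'a set \<Rightarrow> ('a \<Rightarrow> 'a) \<Rightarrow> nat \<Rightarrow> 'a set" where
  "periodic_points Y f n = {x \<in> Y. (f ^^ n) x = x}"

text \<open>Being fixed means being trivial on all multiples of \<open>m = 2 ^ n - 1\<close>. The
  cofactor \<open>s\<close> of \<open>m'\<close> in \<open>m\<close> is invertible in the ring, so
  triviality extends to all multiples of \<open>m'\<close>, and modulo these the ring is generated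
  by 1.\<close>

lemma periodic_points_TS:
  assumes "n > 0"
  shows "finite (periodic_points (characters (RS S)) (TS S) n)"
    and "card (periodic_points (characters (RS S)) (TS S) n) \<le> coprime_part S (2 ^ n - 1)"
proof -
  define m where "m = (2::nat) ^ n - 1"
  define m' where "m' = coprime_part S m"
  have "m > 0" using assms two_power_minus_one_pos by (simp add: m_def)
  then obtain s where s: "m = s * m'" "\<And>p. prime p \<Longrightarrow> p dvd s \<Longrightarrow> p \<in> S"
    using coprime_part_decomp m'_def by blast
  have "s > 0" using s(1) \<open>m > 0\<close> by (auto intro: Nat.gr0I)
  let ?P = "periodic_points (characters (RS S)) (TS S) n"
  have triv: "\<psi> (of_int (int m') * r) = 1" if \<psi>: "\<psi> \<in> ?P" and r: "r \<in> RS S" for \<psi> r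
  proof -
    have char: "\<psi> \<in> characters (RS S)" and fixed: "(TS S ^^ n) \<psi> = \<psi>"
      using \<psi> by (auto simp: periodic_points_def)
    \<comment> \<open>Chosen so that \<open>m * t\<close> equals \<open>m' * r\<close>.\<close>
    define t where "t = r / of_nat s"
    have t: "t \<in> RS S" unfolding t_def using r \<open>s > 0\<close> s(2) by (rule RS_divide_of_nat)
    have "2 ^ n * t = of_int (int m) * t + t"
      by (simp add: m_def algebra_simps)
    then have "\<psi> t = \<psi> (of_int (int m) * t + t)"
      using funpow_TS_apply[OF t, of n \<psi>] fixed by simp
    also have "\<dots> = \<psi> (of_int (int m) * t) * \<psi> t"
      by (rule characters_add[OF char RS_of_int_mult[OF t] t])
    finally have "\<psi> t = \<psi> (of_int (int m) * t) * \<psi> t" .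
    then have "\<psi> (of_int (int m) * t) = 1" using characters_norm[OF char t] by auto
    also have "of_int (int m) * t = of_int (int m') * r"
      using s(1) \<open>s > 0\<close> by (simp add: t_def)
    finally show ?thesis .
  qed
  have sub: "(\<lambda>\<psi>. \<psi> 1) ` ?P \<subseteq> {z. z ^ m' = 1}"
    using triv[OF _ RS_1] characters_RS_of_int_mult[OF _ RS_1, of _ S "int m'"]
    by (fastforce simp: periodic_points_def)
  have inj: "inj_on (\<lambda>\<psi>. \<psi> 1) ?P"
  proof (rule inj_onI)
    fix \<psi> \<phi> assume P: "\<psi> \<in> ?P" "\<phi> \<in> ?P" and eq: "\<psi> 1 = \<phi> 1"
    have "\<psi> r = \<phi> r" if r: "r \<in> RS S" for r
    proof -
      from r obtain a b where ab: "r = of_int a / of_nat b" "b > 0" "\<And>p. prime p \<Longrightarrow> p dvd b \<Longrightarrow> p \<in> S"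
        by (rule RS_cases) blast
      have "coprime b m'"
      proof (rule ccontr)
        assume "\<not> coprime b m'"
        then obtain p where "prime p" "p dvd gcd b m'"
          using prime_factor_nat coprime_iff_gcd_eq_1 by blast
        then have "prime p" "p dvd b" "p dvd coprime_part S m" by (auto simp: m'_def)
        then show False using ab(3) prime_dvd_coprime_part(2) by blast
      qed
      then have "coprime (int b) (int m')" by simp
      then obtain u v where "u * int b + v * int m' = 1"
        using bezout_int coprime_iff_gcd_eq_1 by metis
      \<comment> \<open>Since \<open>b * r = a\<close>, the Bezout relation splits \<open>r\<close>
        into a multiple of 1 and a multiple of \<open>m'\<close>. The second part is killed, so the
        value at 1 determines the value at \<open>r\<close>.\<close>
      then have "r = of_int (u * int b + v * int m') * r" by simp
      also have "\<dots> = of_int (u * a) * 1 + of_int (int m') * (of_int v * r)"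
        using ab by (simp add: field_simps)
      finally have decomp: "r = of_int (u * a) * 1 + of_int (int m') * (of_int v * r)" .
      have "\<omega> r = \<omega> 1 powi (u * a)" if "\<omega> \<in> ?P" for \<omega>
      proof -
        have \<omega>: "\<omega> \<in> characters (RS S)" using that by (simp add: periodic_points_def)
        have "\<omega> r = \<omega> (of_int (u * a) * 1) * \<omega> (of_int (int m') * (of_int v * r))"
          by (subst decomp, rule characters_add[OF \<omega>]) (intro RS_of_int_mult RS_1 r)+
        then show ?thesis
          using triv[OF that RS_of_int_mult[OF r]] characters_RS_of_int_mult[OF \<omega> RS_1] by (simp only: mult_1_right)
      qed
      then show ?thesis using P eq by metis
    qed
    \<comment> \<open>Both functions are \<open>undefined\<close> off the ring, so agreement on the
      ring is equality.\<close>
    moreover have "\<psi> \<in> RS S \<rightarrow>\<^sub>E sphere 0 1" "\<phi> \<in> RS S \<rightarrow>\<^sub>E sphere 0 1"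
      using P by (simp_all add: periodic_points_def characters_def)
    ultimately show "\<psi> = \<phi>" by (intro PiE_ext)
  qed
  have m': "m' > 0" by (simp add: m'_def coprime_part_pos)
  then have fin: "finite {z::complex. z ^ m' = 1}"
    by (simp add: card_ge_0_finite card_roots_unity_eq)
  show "finite ?P" using finite_subset[OF sub fin] inj by (rule finite_imageD)
  show "card ?P \<le> coprime_part S (2 ^ n - 1)"
    using card_inj_on_le[OF inj sub fin] card_roots_unity_eq[OF m']
    by (simp add: m'_def m_def)
qed

section \<open>Counting closed orbits\<close>

text \<open>A cycle is the forward orbit of each of its points. Hence two closed orbits with a
  common point coincide.\<close>

lemma closed_orbit_eq_range:
  assumes "n > 0" "(f ^^ n) x = x" "y = (f ^^ i) x"
  shows "(\<lambda>j. (f ^^ j) x) ` {0..n} = range (\<lambda>j. (f ^^ j) y)"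
proof (intro equalityI subsetI)
  fix z assume "z \<in> (\<lambda>j. (f ^^ j) x) ` {0..n}"
  then obtain j where "z = (f ^^ j) x" by auto
  \<comment> \<open>Adding \<open>i\<close> full turns makes the exponent at least \<open>i\<close>,
    so that the iterate can be started at \<open>y\<close> even when \<open>j < i\<close>.\<close>
  also have "\<dots> = (f ^^ ((j + i * n) mod n)) x"
    using funpow_mod_eq[OF assms(2)] by simp
  also have "\<dots> = (f ^^ (j + i * n)) x" by (rule funpow_mod_eq[OF assms(2)])
  also have "j + i * n = (j + i * (n - 1)) + i" using assms(1) by (cases n) auto
  also have "(f ^^ \<dots>) x = (f ^^ (j + i * (n - 1))) y" by (simp only: funpow_add assms(3) o_apply)
  finally show "z \<in> range (\<lambda>j. (f ^^ j) y)" by blast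
next
  fix z assume "z \<in> range (\<lambda>j. (f ^^ j) y)"
  then obtain j where "z = (f ^^ (j + i)) x" using assms(3) by (auto simp: funpow_add)
  then have "z = (f ^^ ((j + i) mod n)) x" using funpow_mod_eq[OF assms(2)] by simp
  then show "z \<in> (\<lambda>j. (f ^^ j) x) ` {0..n}"
    using assms(1) by (auto intro!: imageI simp: less_imp_le)
qed

text \<open>The orbits of length \<open>n\<close> are pairwise disjoint, have \<open>n\<close>
  elements each and consist of points fixed by the \<open>n\<close>-th iterate.\<close>

lemma card_closed_orbits_le:
  assumes "f \<in> Y \<rightarrow> Y" "finite (periodic_points Y f n)"
  shows "finite {\<tau> \<in> closed_orbits Y f. card \<tau> = n}"
    and "n * card {\<tau> \<in> closed_orbits Y f. card \<tau> = n} \<le> card (periodic_points Y f n)"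
proof -
  let ?O = "{\<tau> \<in> closed_orbits Y f. card \<tau> = n}"
  have inY: "(f ^^ i) x \<in> Y" if "x \<in> Y" for x i
    using that assms(1) by (induction i) auto
  have rep: "\<tau> \<subseteq> periodic_points Y f n \<and> (\<forall>y\<in>\<tau>. \<tau> = range (\<lambda>j. (f ^^ j) y))" if \<tau>: "\<tau> \<in> ?O" for \<tau>
  proof -
    obtain x where x: "x \<in> Y" "n > 0" "(f ^^ n) x = x" "\<tau> = (\<lambda>i. (f ^^ i) x) ` {0..n}"
      using \<tau> by (auto simp: closed_orbits_def)
    have "\<tau> \<subseteq> periodic_points Y f n"
    proof
      fix y assume "y \<in> \<tau>"
      then obtain i where i: "y = (f ^^ i) x" using x by auto
      have "(f ^^ n) y = (f ^^ i) ((f ^^ n) x)"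
        unfolding i by (metis add.commute comp_apply funpow_add)
      then show "y \<in> periodic_points Y f n"
        using i x inY by (simp add: periodic_points_def)
    qed
    moreover have "\<tau> = range (\<lambda>j. (f ^^ j) y)" if "y \<in> \<tau>" for y
      using that closed_orbit_eq_range[OF x(2,3)] x(4) by blast
    ultimately show ?thesis by blast
  qed
  have sub: "?O \<subseteq> Pow (periodic_points Y f n)" using rep by blast
  then show fin: "finite ?O" using assms(2) by (meson finite_Pow_iff finite_subset)
  have "pairwise disjnt ?O"
  proof (rule pairwiseI)
    fix \<tau> \<sigma> assume \<tau>\<sigma>: "\<tau> \<in> ?O" "\<sigma> \<in> ?O" "\<tau> \<noteq> \<sigma>"
    have False if "y \<in> \<tau>" "y \<in> \<sigma>" for y
    proof -
      have "\<tau> = range (\<lambda>j. (f ^^ j) y)" "\<sigma> = range (\<lambda>j. (f ^^ j) y)"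
        using rep[OF \<tau>\<sigma>(1)] rep[OF \<tau>\<sigma>(2)] that by blast+
      then show False using \<tau>\<sigma>(3) by simp
    qed
    then show "disjnt \<tau> \<sigma>" unfolding disjnt_iff by blast
  qed
  then have "card (\<Union>?O) = (\<Sum>\<tau>\<in>?O. card \<tau>)"
    using sub assms(2) by (intro card_Union_disjoint) (auto intro: finite_subset)
  also have "\<dots> = n * card ?O" by simp
  finally have "card (\<Union>?O) = n * card ?O" .
  moreover have "\<Union>?O \<subseteq> periodic_points Y f n" using sub by blast
  ultimately show "n * card ?O \<le> card (periodic_points Y f n)"
    using assms(2) by (metis card_mono)
qed

text \<open>Group the orbits by length: with entropy \<open>ln 2\<close>, an orbit of length
  \<open>n\<close> has weight \<open>1 / 2 ^ n\<close>, and the number of such orbits is bounded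
  through the periodic points.\<close>

lemma MS_le:
  assumes "topological_entropy (dual_RS S) (TS S) = ereal (ln 2)"
  shows "MS S N \<le> (\<Sum>n\<in>{1..N}. real (coprime_part S (2 ^ n - 1)) / (real n * 2 ^ n))"
proof -
  let ?C = "closed_orbits (characters (RS S)) (TS S)"
  define Orb where "Orb n = {\<tau> \<in> ?C. card \<tau> = n}" for n
  have map: "TS S \<in> characters (RS S) \<rightarrow> characters (RS S)" using TS_in_characters by blast
  have Orb: "finite (Orb n)" "real (card (Orb n)) \<le> real (coprime_part S (2 ^ n - 1)) / real n" if "n > 0" for n
  proof -
    note c = card_closed_orbits_le[OF map periodic_points_TS(1)[OF that, of S]]
    show "finite (Orb n)" unfolding Orb_def by (rule c(1))
    have "n * card (Orb n) \<le> coprime_part S (2 ^ n - 1)"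
      using c(2) periodic_points_TS(2)[OF that, of S] by (simp add: Orb_def)
    then have "real n * real (card (Orb n)) \<le> real (coprime_part S (2 ^ n - 1))"
      by (metis of_nat_le_iff of_nat_mult)
    then show "real (card (Orb n)) \<le> real (coprime_part S (2 ^ n - 1)) / real n"
      using that by (simp add: field_simps)
  qed
  have split: "{\<tau>. \<tau> \<in> ?C \<and> card \<tau> \<le> N} = (\<Union>n\<in>{1..N}. Orb n)"
    by (auto simp: Orb_def closed_orbits_def)
  have expo: "exp (- ln 2 * real k) = 1 / 2 ^ k" for k
    by (simp add: exp_minus exp_of_nat_mult field_simps)
  have "MS S N = (\<Sum>\<tau>\<in>(\<Union>n\<in>{1..N}. Orb n). 1 / 2 ^ card \<tau>)"
    unfolding MS_def assms topspace_dual_RS split[symmetric] by (simp only: real_of_ereal.simps expo)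
  also have "\<dots> = (\<Sum>n\<in>{1..N}. \<Sum>\<tau>\<in>Orb n. 1 / 2 ^ card \<tau>)"
    by (intro sum.UNION_disjoint) (auto simp: Orb, auto simp: Orb_def)
  also have "\<dots> = (\<Sum>n\<in>{1..N}. real (card (Orb n)) / 2 ^ n)"
    by (intro sum.cong) (auto simp: Orb_def)
  also have "\<dots> \<le> (\<Sum>n\<in>{1..N}. real (coprime_part S (2 ^ n - 1)) / real n / 2 ^ n)"
    by (intro sum_mono divide_right_mono Orb) auto
  finally show ?thesis by simp
qed

section \<open>Topological entropy\<close>

text \<open>A chord is no longer than its arc.\<close>

lemma norm_cis_diff_le: "norm (cis a - cis b) \<le> \<bar>a - b\<bar>"
proof -
  have "cis a - cis b = cis b * (cis (a - b) - 1)"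
    by (simp add: right_diff_distrib cis_mult)
  then have "cis a - cis b = cis b * (exp (\<i> * of_real (a - b)) - 1)"
    by (simp only: cis_conv_exp)
  then have "norm (cis a - cis b) = 2 * \<bar>sin ((a - b) / 2)\<bar>"
    using dist_exp_i_1[of "a - b"] by (simp only: norm_mult norm_cis mult_1_left dist_norm)
  also have "\<dots> \<le> \<bar>a - b\<bar>" using abs_sin_x_le_abs_x[of "(a - b) / 2"] by simp
  finally show ?thesis .
qed

lemma unit_circle_net:
  fixes z :: complex
  assumes "norm z = 1" "M > 0"
  obtains j where "j < M" "norm (z - cis (2 * pi * real j / real M)) \<le> 2 * pi / real M"
proof -
  obtain t where t: "0 \<le> t" "t < 2 * pi" "z = cis t"
    using complex_unimodular_polar[OF assms(1)] by (metis cis.code)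
  define j where "j = nat \<lfloor>t * real M / (2 * pi)\<rfloor>"
  have j: "real j \<le> t * real M / (2 * pi)" "t * real M / (2 * pi) < real j + 1"
    using t by (simp_all add: j_def)
  have "t * real M / (2 * pi) < real M" using t assms(2) by (simp add: field_simps)
  then have "j < M" using j by linarith
  moreover have "2 * pi * real j / real M \<le> t" "t \<le> 2 * pi * real j / real M + 2 * pi / real M"
    using j assms(2) by (simp_all add: field_simps)
  then have "\<bar>t - 2 * pi * real j / real M\<bar> \<le> 2 * pi / real M" by (simp add: abs_le_iff)
  then have "norm (z - cis (2 * pi * real j / real M)) \<le> 2 * pi / real M"
    using norm_cis_diff_le t(3) order_trans by blast
  ultimately show ?thesis by (rule that)
qed

text \<open>Negative exponents reduce to positive ones because inversion is an isometry of the unit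
  circle.\<close>

lemma norm_power_int_diff_le:
  fixes z w :: complex
  assumes "norm z = 1" "norm w = 1"
  shows "norm (z powi k - w powi k) \<le> of_int \<bar>k\<bar> * norm (z - w)"
proof (cases k rule: int_cases2)
  case (nonneg n)
  then show ?thesis using norm_power_diff[of z w n] assms by simp
next
  case (nonpos n)
  have nz: "z \<noteq> 0" "w \<noteq> 0" using assms by auto
  have "norm (inverse z - inverse w) = norm (z - w)"
    by (simp add: inverse_diff_inverse[OF nz] norm_mult norm_inverse assms)
  then show ?thesis
    using norm_power_diff[of "inverse z" "inverse w" n] assms nonpos
    by (simp add: power_int_minus norm_inverse flip: power_inverse)
qed

section \<open>Compactness and counting covers\<close>

text \<open>The product of circles is compact by Tychonoff, and each homomorphism equation cuts out
  a closed set, the zero set of a continuous function.\<close>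

lemma compact_space_dual_topology:
  assumes "A \<noteq> {}" "\<And>r s. r \<in> A \<Longrightarrow> s \<in> A \<Longrightarrow> r + s \<in> A"
  shows "compact_space (dual_topology A)"
proof -
  let ?P = "product_topology (\<lambda>_. euclidean :: complex topology) A"
  define K where "K = (\<Inter>(r, s)\<in>A \<times> A. {\<psi> \<in> topspace ?P. \<psi> (r + s) - \<psi> r * \<psi> s \<in> {0}})"
  have "closedin ?P {\<psi> \<in> topspace ?P. \<psi> (r + s) - \<psi> r * \<psi> s \<in> {0}}" if "r \<in> A" "s \<in> A" for r s
  proof -
    have "continuous_map ?P (prod_topology euclidean (prod_topology euclidean euclidean))
        (\<lambda>\<psi>. (\<psi> (r + s), \<psi> r, \<psi> s))"
      using that assms(2) by (intro continuous_map_pairedI continuous_map_product_projection)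
    then have c: "continuous_map ?P euclidean (\<lambda>\<psi>. (\<psi> (r + s), \<psi> r, \<psi> s))"
      by simp
    have "continuous_map euclidean euclidean (\<lambda>(a, b, c). a - b * c :: complex)"
      by (auto simp: case_prod_unfold intro!: continuous_intros)
    from continuous_map_compose[OF c this]
    have "continuous_map ?P euclidean (\<lambda>\<psi>. \<psi> (r + s) - \<psi> r * \<psi> s)"
      by (simp add: o_def)
    then show ?thesis by (rule closedin_continuous_map_preimage) simp
  qed
  then have "closedin ?P K" unfolding K_def
    using assms(1) by (intro closedin_INT) auto
  moreover have "compactin ?P (A \<rightarrow>\<^sub>E sphere 0 1)"
    by (simp add: compactin_PiE)
  ultimately have "compactin ?P (K \<inter> (A \<rightarrow>\<^sub>E sphere 0 1))"
    by (rule closed_Int_compactin)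
  also have "K \<inter> (A \<rightarrow>\<^sub>E sphere 0 1) = characters A"
    using assms(1) unfolding K_def characters_def by (auto simp: PiE_iff extensional_def)
  finally show ?thesis by (simp add: compactin_subspace dual_topology_def)
qed

lemma subcover_number_le:
  assumes "V \<subseteq> U" "finite V" "\<Union>V = topspace Y"
  shows "subcover_number Y U \<le> card V"
  unfolding subcover_number_def using assms by (intro Least_le) blast

text \<open>Pigeonhole: \<open>m\<close> points, no two in a common member, need \<open>m\<close>
  members.\<close>

lemma subcover_number_ge:
  assumes "finite U" "\<Union>U = topspace Y"
    and "\<And>j. j < m \<Longrightarrow> e j \<in> topspace Y"
    and "\<And>j k W. W \<in> U \<Longrightarrow> j < k \<Longrightarrow> k < m \<Longrightarrow> e j \<in> W \<Longrightarrow> e k \<notin> W"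
  shows "m \<le> subcover_number Y U"
proof -
  \<comment> \<open>The least number is attained because the finite cover \<open>U\<close> is itself
    a candidate.\<close>
  have "\<exists>V\<subseteq>U. finite V \<and> card V = subcover_number Y U \<and> \<Union>V = topspace Y"
    unfolding subcover_number_def by (rule LeastI_ex) (use assms(1,2) in blast)
  then obtain V where V: "V \<subseteq> U" "finite V" "card V = subcover_number Y U" "\<Union>V = topspace Y"
    by blast
  have "\<forall>j\<in>{..<m}. \<exists>W\<in>V. e j \<in> W" using assms(3) V(4) by blast
  then obtain W where W: "\<And>j. j < m \<Longrightarrow> W j \<in> V \<and> e j \<in> W j" by (metis lessThan_iff)
  have "inj_on W {..<m}"
    using W assms(4) V(1) by (intro inj_onI) (metis lessThan_iff linorder_neqE_nat subset_iff)
  then have "card {..<m} \<le> card V"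
    using V(2) W by (intro card_inj_on_le[of W]) auto
  then show ?thesis using V(3) by simp
qed

text \<open>Only the values of \<open>u\<close> below \<open>n\<close> matter, so restricted choice
  functions, finitely many, produce every member.\<close>

lemma finite_iterated_cover:
  assumes "finite U"
  shows "finite (iterated_cover Y f U n)"
proof -
  have "iterated_cover Y f U n \<subseteq>
      (\<lambda>u. {x \<in> topspace Y. \<forall>i<n. (f ^^ i) x \<in> u i}) ` ({..<n} \<rightarrow>\<^sub>E U)"
  proof
    fix W assume "W \<in> iterated_cover Y f U n"
    then obtain u where u: "W = {x \<in> topspace Y. \<forall>i<n. (f ^^ i) x \<in> u i}" "\<forall>i<n. u i \<in> U"
      by (auto simp: iterated_cover_def)
    then have "W = {x \<in> topspace Y. \<forall>i<n. (f ^^ i) x \<in> restrict u {..<n} i}" by auto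
    moreover have "restrict u {..<n} \<in> {..<n} \<rightarrow>\<^sub>E U" using u(2) by auto
    ultimately show "W \<in> (\<lambda>u. {x \<in> topspace Y. \<forall>i<n. (f ^^ i) x \<in> u i}) ` ({..<n} \<rightarrow>\<^sub>E U)" by blast
  qed
  then show ?thesis using assms by (meson finite_PiE finite_imageI finite_lessThan finite_subset)
qed

lemma Union_iterated_cover:
  assumes "f \<in> topspace Y \<rightarrow> topspace Y" "\<Union>U = topspace Y"
  shows "\<Union>(iterated_cover Y f U n) = topspace Y"
proof
  show "\<Union>(iterated_cover Y f U n) \<subseteq> topspace Y" by (auto simp: iterated_cover_def)
  show "topspace Y \<subseteq> \<Union>(iterated_cover Y f U n)"
  proof
    fix x assume x: "x \<in> topspace Y"
    have "(f ^^ i) x \<in> topspace Y" for i using x assms(1) by (induction i) auto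
    then have "\<exists>W. W \<in> U \<and> (f ^^ i) x \<in> W" for i using assms(2) by blast
    then obtain u where "\<And>i. u i \<in> U \<and> (f ^^ i) x \<in> u i" by metis
    then show "x \<in> \<Union>(iterated_cover Y f U n)" using x unfolding iterated_cover_def by blast
  qed
qed

lemma continuous_map_dual_RS_apply: "r \<in> RS S \<Longrightarrow> continuous_map (dual_RS S) euclidean (\<lambda>\<psi>. \<psi> r)"
  unfolding dual_RS_def dual_topology_def
  by (intro continuous_map_from_subtopology continuous_map_product_projection)

lemma openin_dual_RS_preimage:
  assumes "r \<in> RS S" "open T"
  shows "openin (dual_RS S) {\<psi> \<in> characters (RS S). \<psi> r \<in> T}"
  using openin_continuous_map_preimage[OF continuous_map_dual_RS_apply[OF assms(1)], of T] assms(2)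
  by (simp add: topspace_dual_RS)

section \<open>Lower bound for the entropy\<close>

text \<open>The one-parameter subgroup of the dual that comes from viewing the ring inside the
  reals. It provides a character with any prescribed angle at 1.\<close>

definition line_character :: "nat set \<Rightarrow> real \<Rightarrow> rat \<Rightarrow> complex" where
  "line_character S \<theta> = (\<lambda>r\<in>RS S. cis (\<theta> * of_rat r))"

lemma line_character_in_characters: "line_character S \<theta> \<in> characters (RS S)"
  by (auto simp: line_character_def characters_def RS_add of_rat_add distrib_left cis_mult)

text \<open>On the value at 1 the map doubles angles. For the cover by four open half-circles,
  \<open>2 ^ n\<close> equally spaced angles are pairwise separated within \<open>n\<close> steps,
  so no subcover of the iterated cover has fewer than \<open>2 ^ n\<close> members.\<close>

lemma topological_entropy_TS_ge: "ereal (ln 2) \<le> topological_entropy (dual_RS S) (TS S)"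
proof -
  define H where "H c = {\<psi> \<in> characters (RS S). \<psi> 1 \<in> {z. Re (c * z) > 0}}" for c
  define U where "U = H ` {1, -1, \<i>, -\<i>}"
  let ?f = "TS S" and ?Y = "dual_RS S"
  have "openin ?Y (H c)" for c
    unfolding H_def
    by (intro openin_dual_RS_preimage RS_1 open_Collect_less continuous_intros)
  moreover have UU: "\<Union>U = topspace ?Y"
  proof
    show "topspace ?Y \<subseteq> \<Union>U"
    proof
      fix \<psi> assume "\<psi> \<in> topspace ?Y"
      then have \<psi>: "\<psi> \<in> characters (RS S)" by (simp add: topspace_dual_RS)
      then have "\<psi> 1 \<noteq> 0" using characters_norm[OF \<psi> RS_1] by auto
      then have "Re (\<psi> 1) > 0 \<or> Re (\<psi> 1) < 0 \<or> Im (\<psi> 1) > 0 \<or> Im (\<psi> 1) < 0"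
        by (auto simp: complex_eq_iff)
      then show "\<psi> \<in> \<Union>U" using \<psi> by (auto simp: U_def H_def)
    qed
  qed (auto simp: U_def H_def topspace_dual_RS)
  ultimately have cover: "open_cover ?Y U" by (auto simp: open_cover_def U_def)
  have map: "?f \<in> topspace ?Y \<rightarrow> topspace ?Y"
    using TS_in_characters by (auto simp: topspace_dual_RS)
  \<comment> \<open>No member of the cover contains two characters with antipodal values at 1. If \<open>k - j\<close> is \<open>2\<^sup>a\<close>
    times an odd number, the characters \<open>e j\<close> and \<open>e k\<close> have antipodal values after \<open>n - 1 - a\<close> steps.\<close>
  have sep: "2 ^ n \<le> subcover_number ?Y (iterated_cover ?Y ?f U n)" for n
  proof (rule subcover_number_ge)
    show "finite (iterated_cover ?Y ?f U n)" by (rule finite_iterated_cover) (simp add: U_def)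
    show "\<Union>(iterated_cover ?Y ?f U n) = topspace ?Y" by (rule Union_iterated_cover[OF map UU])
    define e where "e j = line_character S (2 * pi * real j / 2 ^ n)" for j
    have e: "e j \<in> characters (RS S)" for j by (simp add: e_def line_character_in_characters)
    then show "e j \<in> topspace ?Y" for j by (simp add: topspace_dual_RS)
    show "e k \<notin> W" if W: "W \<in> iterated_cover ?Y ?f U n" and jk: "j < k" "k < 2 ^ n" and j: "e j \<in> W" for j k W
    proof
      assume k: "e k \<in> W"
      define a where "a = multiplicity 2 (k - j)"
      obtain b where b: "k - j = 2 ^ a * b" "odd b"
        using multiplicity_decompose'[of "k - j" 2] jk by (auto simp: a_def)
      \<comment> \<open>This yields \<open>a < n\<close>, so the separation time
        \<open>n - 1 - a\<close> involves no truncated subtraction.\<close>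
      have "(2::nat) ^ a \<le> k - j" using b by (cases b) auto
      also have "\<dots> < 2 ^ n" using jk by simp
      finally have "a < n" by simp
      define i where "i = n - 1 - a"
      have i: "i < n" "n = Suc (i + a)" using \<open>a < n\<close> by (auto simp: i_def)
      have val: "(?f ^^ i) (e l) 1 = cis (2 ^ i * (2 * pi * real l / 2 ^ n))" for l
      proof -
        have "(?f ^^ i) (e l) 1 = cis (2 * pi * real l / 2 ^ n) ^ 2 ^ i"
          using funpow_TS_apply_power[OF e RS_1, of i l] RS_1
          by (simp add: e_def line_character_def)
        also have "\<dots> = cis (real (2 ^ i) * (2 * pi * real l / 2 ^ n))" by (rule Complex.DeMoivre)
        finally show ?thesis by simp
      qed
      have "real k = real j + 2 ^ a * real b"
      proof -
        have "k = j + 2 ^ a * b" using b jk by simp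
        then show ?thesis by simp
      qed
      then have "2 ^ i * (2 * pi * real k / 2 ^ n) = 2 ^ i * (2 * pi * real j / 2 ^ n) + real b * pi"
        by (simp add: i(2) power_add field_simps)
      then have anti: "(?f ^^ i) (e k) 1 = - (?f ^^ i) (e j) 1"
        using b(2) by (simp add: val cis.ctr cos_add sin_add complex_eq_iff)
      obtain u where u: "W = {x \<in> topspace ?Y. \<forall>i<n. (?f ^^ i) x \<in> u i}" "\<forall>i<n. u i \<in> U"
        using W by (auto simp: iterated_cover_def)
      then have "(?f ^^ i) (e j) \<in> u i" "(?f ^^ i) (e k) \<in> u i" "u i \<in> U"
        using i j k by auto
      then obtain c where "(?f ^^ i) (e j) \<in> H c" "(?f ^^ i) (e k) \<in> H c" by (auto simp: U_def)
      then show False by (simp add: H_def anti)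
    qed
  qed
  have "ln 2 \<le> ln (real (subcover_number ?Y (iterated_cover ?Y ?f U n))) / real n" if "n > 0" for n
  proof -
    have "real n * ln 2 = ln (2 ^ n)" by (simp add: ln_realpow)
    also have "\<dots> \<le> ln (real (subcover_number ?Y (iterated_cover ?Y ?f U n)))"
    proof (rule ln_mono)
      have "real (2 ^ n) \<le> real (subcover_number ?Y (iterated_cover ?Y ?f U n))"
        using sep[of n] by (simp only: of_nat_le_iff)
      then show "2 ^ n \<le> real (subcover_number ?Y (iterated_cover ?Y ?f U n))" by simp
    qed simp
    finally show ?thesis using that by (simp add: field_simps)
  qed
  then have "ereal (ln 2) \<le> cover_entropy ?Y ?f U"
    unfolding cover_entropy_def
    by (intro le_Limsup) (auto intro: eventually_mono[OF eventually_gt_at_top[of 0]])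
  also have "\<dots> \<le> topological_entropy ?Y ?f"
    unfolding topological_entropy_def using cover by (intro SUP_upper) simp
  finally show ?thesis .
qed

section \<open>Upper bound for the entropy\<close>

lemma characters_RS_Lipschitz:
  assumes "\<psi> \<in> characters (RS S)" "\<phi> \<in> characters (RS S)" "g \<in> RS S"
  shows "norm (\<psi> (of_int k * g) - \<phi> (of_int k * g)) \<le> of_int \<bar>k\<bar> * norm (\<psi> g - \<phi> g)"
  using assms norm_power_int_diff_le[of "\<psi> g" "\<phi> g" k]
  by (simp add: characters_RS_of_int_mult characters_norm)

text \<open>All elements of \<open>F\<close> are integer multiples of one \<open>g\<close>, so
  closeness at \<open>g\<close> bounds every difference, uniformly in both characters.\<close>

lemma characters_RS_uniform:
  assumes "finite F" "F \<subseteq> RS S" "\<And>r. r \<in> F \<Longrightarrow> \<epsilon> r > 0"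
  shows "\<exists>g\<in>RS S. \<exists>\<delta>>0. \<forall>\<psi>\<in>characters (RS S). \<forall>\<phi>\<in>characters (RS S).
    norm (\<psi> g - \<phi> g) < \<delta> \<longrightarrow> (\<forall>r\<in>F. norm (\<psi> r - \<phi> r) < \<epsilon> r)"
proof -
  obtain g where g: "g \<in> RS S" "\<And>r. r \<in> F \<Longrightarrow> \<exists>k::int. r = of_int k * g"
    using RS_common_generator[OF assms(1,2)] by blast
  then obtain k :: "rat \<Rightarrow> int" where k: "\<And>r. r \<in> F \<Longrightarrow> r = of_int (k r) * g" by metis
  \<comment> \<open>The inserted 1 covers empty \<open>F\<close>; the added 1 in the denominator
    covers a zero multiplier.\<close>
  define \<delta> where "\<delta> = Min (insert 1 ((\<lambda>r. \<epsilon> r / (of_int \<bar>k r\<bar> + 1)) ` F))"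
  have pos: "of_int \<bar>k r\<bar> + 1 > (0::real)" for r by (simp add: add_nonneg_pos)
  have "\<delta> > 0" unfolding \<delta>_def using assms(1,3) pos by (subst Min_gr_iff) auto
  moreover have "norm (\<psi> r - \<phi> r) < \<epsilon> r"
    if "\<psi> \<in> characters (RS S)" "\<phi> \<in> characters (RS S)" "norm (\<psi> g - \<phi> g) < \<delta>" "r \<in> F" for \<psi> \<phi> r
  proof -
    have "\<delta> \<le> \<epsilon> r / (of_int \<bar>k r\<bar> + 1)" unfolding \<delta>_def using assms(1) that(4) by (intro Min_le) auto
    then have "(of_int \<bar>k r\<bar> + 1) * \<delta> \<le> \<epsilon> r" using pos[of r] by (simp add: field_simps)
    have "norm (\<psi> r - \<phi> r) \<le> of_int \<bar>k r\<bar> * norm (\<psi> g - \<phi> g)"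
      using characters_RS_Lipschitz[OF that(1,2) g(1), of "k r"] k[OF that(4)] by simp
    also have "\<dots> \<le> of_int \<bar>k r\<bar> * \<delta>" using that(3) by (intro mult_left_mono) auto
    also have "\<dots> < (of_int \<bar>k r\<bar> + 1) * \<delta>" using \<open>\<delta> > 0\<close> by (simp add: distrib_right)
    also have "\<dots> \<le> \<epsilon> r" by fact
    finally show ?thesis .
  qed
  ultimately show ?thesis using g(1) by blast
qed

text \<open>A basic neighbourhood restricts only finitely many coordinates, and these merge into
  one.\<close>

lemma dual_RS_local_base:
  assumes "openin (dual_RS S) u" "\<phi> \<in> u"
  shows "\<exists>g\<in>RS S. \<exists>\<delta>>0. \<forall>\<psi>\<in>characters (RS S). norm (\<psi> g - \<phi> g) < \<delta> \<longrightarrow> \<psi> \<in> u"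
proof -
  obtain T where T: "openin (product_topology (\<lambda>_. euclidean) (RS S)) T" "u = T \<inter> characters (RS S)"
    using assms(1) by (auto simp: dual_RS_def dual_topology_def openin_subtopology)
  have \<phi>: "\<phi> \<in> T" "\<phi> \<in> characters (RS S)" using assms(2) T(2) by auto
  obtain V where V: "finite {r \<in> RS S. V r \<noteq> UNIV}" "\<And>r. r \<in> RS S \<Longrightarrow> open (V r)"
      "\<phi> \<in> Pi\<^sub>E (RS S) V" "Pi\<^sub>E (RS S) V \<subseteq> T"
    using T(1) \<phi>(1) unfolding openin_product_topology_alt by auto
  define F where "F = {r \<in> RS S. V r \<noteq> UNIV}"
  have "\<forall>r\<in>F. \<exists>e>0. \<forall>z. dist z (\<phi> r) < e \<longrightarrow> z \<in> V r"
    using V(2,3) by (auto simp: F_def open_dist PiE_iff)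
  then obtain \<epsilon> where \<epsilon>: "\<And>r. r \<in> F \<Longrightarrow> \<epsilon> r > 0" "\<And>r z. r \<in> F \<Longrightarrow> dist z (\<phi> r) < \<epsilon> r \<Longrightarrow> z \<in> V r"
    by metis
  have F: "finite F" "F \<subseteq> RS S" using V(1) by (auto simp: F_def)
  have "\<exists>g\<in>RS S. \<exists>\<delta>>0. \<forall>\<psi>\<in>characters (RS S). \<forall>\<phi>\<in>characters (RS S).
    norm (\<psi> g - \<phi> g) < \<delta> \<longrightarrow> (\<forall>r\<in>F. norm (\<psi> r - \<phi> r) < \<epsilon> r)"
    by (rule characters_RS_uniform[OF F]) (rule \<epsilon>(1))
  then obtain g \<delta> where g: "g \<in> RS S" "\<delta> > 0"
    "\<forall>\<psi>\<in>characters (RS S). norm (\<psi> g - \<phi> g) < \<delta> \<longrightarrow> (\<forall>r\<in>F. norm (\<psi> r - \<phi> r) < \<epsilon> r)"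
    using \<phi>(2) by blast
  have "\<psi> \<in> u" if \<psi>: "\<psi> \<in> characters (RS S)" "norm (\<psi> g - \<phi> g) < \<delta>" for \<psi>
  proof -
    have "\<psi> r \<in> V r" if "r \<in> RS S" for r
    proof (cases "r \<in> F")
      case True
      then show ?thesis using g(3) \<psi> \<epsilon>(2) by (simp add: dist_norm)
    next
      case False
      then show ?thesis using that by (simp add: F_def)
    qed
    moreover have "\<psi> \<in> extensional (RS S)" using \<psi>(1) by (simp add: characters_def PiE_iff)
    ultimately have "\<psi> \<in> Pi\<^sub>E (RS S) V" by (simp add: PiE_iff)
    then show ?thesis using V(4) \<psi>(1) T(2) by blast
  qed
  then show ?thesis using g(1,2) by blast
qed

text \<open>The Lebesgue number lemma for the distance measured at one coordinate \<open>g\<close>.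
  Compactness leaves finitely many balls, each with its own coordinate, and the uniform estimate
  replaces these by a common one.\<close>

lemma dual_RS_Lebesgue:
  assumes "open_cover (dual_RS S) U"
  shows "\<exists>g\<in>RS S. \<exists>\<delta>>0. \<forall>\<phi>\<in>characters (RS S).
    \<exists>u\<in>U. \<forall>\<psi>\<in>characters (RS S). norm (\<psi> g - \<phi> g) < \<delta> \<longrightarrow> \<psi> \<in> u"
proof -
  let ?X = "characters (RS S)"
  define good where "good \<phi> g \<delta> \<longleftrightarrow> g \<in> RS S \<and> \<delta> > 0 \<and>
      (\<exists>u\<in>U. \<forall>\<psi>\<in>?X. norm (\<psi> g - \<phi> g) < \<delta> \<longrightarrow> \<psi> \<in> u)" for \<phi> g and \<delta> :: real
  have "\<exists>t. good \<phi> (fst t) (snd t)" if "\<phi> \<in> ?X" for \<phi>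
  proof -
    have "\<phi> \<in> \<Union>U" using assms that by (simp add: open_cover_def topspace_dual_RS)
    then obtain u where u: "u \<in> U" "\<phi> \<in> u" by blast
    then have "openin (dual_RS S) u" using assms by (simp add: open_cover_def)
    from dual_RS_local_base[OF this u(2)] obtain g \<delta> where "good \<phi> g \<delta>"
      unfolding good_def using u(1) by blast
    then have "good \<phi> (fst (g, \<delta>)) (snd (g, \<delta>))" by simp
    then show ?thesis by (rule exI)
  qed
  then obtain t where t: "\<forall>\<phi>\<in>?X. good \<phi> (fst (t \<phi>)) (snd (t \<phi>))"
    using bchoice[of ?X "\<lambda>\<phi> t. good \<phi> (fst t) (snd t)"] by blast
  define g \<delta> where "g \<phi> = fst (t \<phi>)" and "\<delta> \<phi> = snd (t \<phi>)" for \<phi>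
  have loc: "g \<phi> \<in> RS S" "\<delta> \<phi> > 0"
    "\<exists>u\<in>U. \<forall>\<psi>\<in>?X. norm (\<psi> (g \<phi>) - \<phi> (g \<phi>)) < \<delta> \<phi> \<longrightarrow> \<psi> \<in> u" if "\<phi> \<in> ?X" for \<phi>
    using t that by (simp_all add: good_def g_def \<delta>_def)
  \<comment> \<open>Half the radius leaves room for the triangle inequality.\<close>
  define B where "B \<phi> = {\<psi> \<in> ?X. \<psi> (g \<phi>) \<in> ball (\<phi> (g \<phi>)) (\<delta> \<phi> / 2)}" for \<phi>
  have "compact_space (dual_RS S)"
    unfolding dual_RS_def
  proof (rule compact_space_dual_topology)
    show "RS S \<noteq> {}" using RS_1 by blast
  qed (rule RS_add)
  moreover have "\<forall>W\<in>B ` ?X. openin (dual_RS S) W"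
  proof
    fix W assume "W \<in> B ` ?X"
    then obtain \<phi> where "\<phi> \<in> ?X" "W = B \<phi>" by blast
    then show "openin (dual_RS S) W"
      unfolding B_def using openin_dual_RS_preimage[OF loc(1) open_ball] by blast
  qed
  moreover have "topspace (dual_RS S) \<subseteq> \<Union>(B ` ?X)"
  proof
    fix \<phi> assume "\<phi> \<in> topspace (dual_RS S)"
    then have "\<phi> \<in> ?X" by (simp add: topspace_dual_RS)
    moreover from this have "\<phi> \<in> B \<phi>" using loc(2) by (simp add: B_def)
    ultimately show "\<phi> \<in> \<Union>(B ` ?X)" by blast
  qed
  ultimately obtain \<F> where "finite \<F>" "\<F> \<subseteq> B ` ?X" "?X \<subseteq> \<Union>\<F>"
    unfolding compact_space_alt topspace_dual_RS by (elim allE[of _ "B ` ?X"]) auto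
  then obtain \<Phi> where \<Phi>: "finite \<Phi>" "\<Phi> \<subseteq> ?X" "?X \<subseteq> (\<Union>\<phi>\<in>\<Phi>. B \<phi>)"
    using finite_subset_image[of \<F> B ?X] by auto
  \<comment> \<open>Several centres may share a coordinate, so the tolerance is a minimum over them;
    the inserted 1 serves coordinates without a centre.\<close>
  define \<epsilon> where "\<epsilon> r = Min (insert 1 ((\<lambda>\<phi>. \<delta> \<phi> / 2) ` {\<phi> \<in> \<Phi>. g \<phi> = r}))" for r
  have \<epsilon>_pos: "\<epsilon> r > 0" for r
    unfolding \<epsilon>_def using \<Phi> loc by (subst Min_gr_iff) auto
  have \<epsilon>_le: "\<epsilon> (g \<phi>) \<le> \<delta> \<phi> / 2" if "\<phi> \<in> \<Phi>" for \<phi>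
    unfolding \<epsilon>_def using that \<Phi>(1) by (intro Min_le) auto
  have G: "finite (g ` \<Phi>)" "g ` \<Phi> \<subseteq> RS S" using \<Phi> loc by auto
  have "\<exists>h\<in>RS S. \<exists>\<eta>>0. \<forall>\<psi>\<in>?X. \<forall>\<phi>\<in>?X.
      norm (\<psi> h - \<phi> h) < \<eta> \<longrightarrow> (\<forall>r\<in>g ` \<Phi>. norm (\<psi> r - \<phi> r) < \<epsilon> r)"
    by (rule characters_RS_uniform[OF G]) (rule \<epsilon>_pos)
  then obtain h \<eta> where h: "h \<in> RS S" "\<eta> > 0" "\<forall>\<psi>\<in>?X. \<forall>\<phi>\<in>?X.
      norm (\<psi> h - \<phi> h) < \<eta> \<longrightarrow> (\<forall>r\<in>g ` \<Phi>. norm (\<psi> r - \<phi> r) < \<epsilon> r)"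
    by blast
  have "\<exists>u\<in>U. \<forall>\<psi>\<in>?X. norm (\<psi> h - \<phi> h) < \<eta> \<longrightarrow> \<psi> \<in> u" if \<phi>: "\<phi> \<in> ?X" for \<phi>
  proof -
    obtain \<xi> where \<xi>: "\<xi> \<in> \<Phi>" "\<phi> \<in> B \<xi>" using \<Phi>(3) \<phi> by blast
    then have \<xi>X: "\<xi> \<in> ?X" using \<Phi>(2) by blast
    obtain u where u: "u \<in> U" "\<forall>\<psi>\<in>?X. norm (\<psi> (g \<xi>) - \<xi> (g \<xi>)) < \<delta> \<xi> \<longrightarrow> \<psi> \<in> u"
      using loc(3)[OF \<xi>X] by blast
    have "\<psi> \<in> u" if \<psi>: "\<psi> \<in> ?X" "norm (\<psi> h - \<phi> h) < \<eta>" for \<psi>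
    proof -
      have "norm (\<psi> (g \<xi>) - \<phi> (g \<xi>)) < \<delta> \<xi> / 2"
      proof -
        have "norm (\<psi> (g \<xi>) - \<phi> (g \<xi>)) < \<epsilon> (g \<xi>)" using h(3) \<psi> \<phi> \<xi>(1) by blast
        then show ?thesis using \<epsilon>_le[OF \<xi>(1)] by simp
      qed
      moreover have "norm (\<phi> (g \<xi>) - \<xi> (g \<xi>)) < \<delta> \<xi> / 2"
        using \<xi>(2) by (simp add: B_def dist_norm norm_minus_commute)
      ultimately have "norm (\<psi> (g \<xi>) - \<xi> (g \<xi>)) < \<delta> \<xi>"
        using norm_diff_triangle_less[of "\<psi> (g \<xi>)" "\<phi> (g \<xi>)" "\<delta> \<xi> / 2" "\<xi> (g \<xi>)" "\<delta> \<xi> / 2"] by simp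
      then show ?thesis using u(2) \<psi>(1) by blast
    qed
    then show ?thesis using u(1) by blast
  qed
  then show ?thesis using h(1,2) by blast
qed

text \<open>The value at \<open>g\<close> is squared at each step, so distances grow by at most
  \<open>2 ^ n\<close> over the steps considered. Cutting the circle into \<open>C * 2 ^ n\<close>
  small arcs keeps characters from one arc within \<open>\<delta>\<close> for \<open>n\<close>
  steps, hence in one member of the iterated cover.\<close>

lemma subcover_number_iterated_TS_le:
  assumes "open_cover (dual_RS S) U"
  obtains C where "C > 0" "\<And>n. subcover_number (dual_RS S) (iterated_cover (dual_RS S) (TS S) U n) \<le> C * 2 ^ n"
proof -
  let ?X = "characters (RS S)" and ?f = "TS S"
  obtain g \<delta> where g: "g \<in> RS S" "\<delta> > 0" and
    leb: "\<forall>\<phi>\<in>?X. \<exists>u\<in>U. \<forall>\<psi>\<in>?X. norm (\<psi> g - \<phi> g) < \<delta> \<longrightarrow> \<psi> \<in> u"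
    using dual_RS_Lebesgue[OF assms] by blast
  obtain u where u: "\<forall>\<phi>\<in>?X. u \<phi> \<in> U \<and> (\<forall>\<psi>\<in>?X. norm (\<psi> g - \<phi> g) < \<delta> \<longrightarrow> \<psi> \<in> u \<phi>)"
    using bchoice[of ?X "\<lambda>\<phi> u. u \<in> U \<and> (\<forall>\<psi>\<in>?X. norm (\<psi> g - \<phi> g) < \<delta> \<longrightarrow> \<psi> \<in> u)"] leb by blast
  obtain C :: nat where C: "real C > 4 * pi / \<delta>" using reals_Archimedean2 by blast
  have "C > 0" using C g(2) by (intro Nat.gr0I) (simp add: divide_less_0_iff)
  moreover have "subcover_number (dual_RS S) (iterated_cover (dual_RS S) ?f U n) \<le> C * 2 ^ n" for n
  proof -
    define M where "M = C * 2 ^ n"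
    have "M > 0" using \<open>C > 0\<close> by (simp add: M_def)
    define near where "near j = {\<psi> \<in> ?X. norm (\<psi> g - cis (2 * pi * real j / real M)) \<le> 2 * pi / real M}" for j
    \<comment> \<open>Arcs met by no character are dropped, since each remaining arc needs a
      character \<open>\<phi>\<close> whose orbit selects the members of the cover.\<close>
    define J where "J = {j. j < M \<and> near j \<noteq> {}}"
    have "finite J" "card J \<le> M"
      using card_mono[of "{..<M}" J] by (auto simp: J_def subset_iff)
    have near_sub: "\<exists>W\<in>iterated_cover (dual_RS S) ?f U n. near j \<subseteq> W" if "j \<in> J" for j
    proof -
      obtain \<phi> where \<phi>: "\<phi> \<in> near j" using \<open>j \<in> J\<close> by (auto simp: J_def)
      then have \<phi>X: "\<phi> \<in> ?X" by (simp add: near_def)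
      define W where "W = {x \<in> topspace (dual_RS S). \<forall>i<n. (?f ^^ i) x \<in> u ((?f ^^ i) \<phi>)}"
      have "W \<in> iterated_cover (dual_RS S) ?f U n"
        unfolding iterated_cover_def W_def using u funpow_TS_in_characters[OF \<phi>X]
        by (intro CollectI exI[of _ "\<lambda>i. u ((?f ^^ i) \<phi>)"]) simp
      moreover have "near j \<subseteq> W"
      proof
        fix \<psi> assume \<psi>: "\<psi> \<in> near j"
        then have \<psi>X: "\<psi> \<in> ?X" by (simp add: near_def)
        have "norm (\<psi> g - \<phi> g) \<le> 2 * pi / real M + 2 * pi / real M"
          using \<phi> \<psi> unfolding near_def mem_Collect_eq
          by (metis norm_diff_triangle_le norm_minus_commute)
        then have close: "norm (\<psi> g - \<phi> g) \<le> 4 * pi / real M" by simp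
        have "norm ((?f ^^ i) \<psi> g - (?f ^^ i) \<phi> g) < \<delta>" if "i < n" for i
        proof -
          have "norm ((?f ^^ i) \<psi> g - (?f ^^ i) \<phi> g) = norm (\<psi> g ^ (2 ^ i) - \<phi> g ^ (2 ^ i))"
            by (simp only: funpow_TS_apply_power[OF \<psi>X g(1)] funpow_TS_apply_power[OF \<phi>X g(1)])
          also have "\<dots> \<le> real (2 ^ i) * norm (\<psi> g - \<phi> g)"
            by (intro norm_power_diff) (simp_all add: characters_norm[OF \<psi>X g(1)] characters_norm[OF \<phi>X g(1)])
          also have "\<dots> \<le> 2 ^ n * (4 * pi / real M)"
            using close that by (intro mult_mono) auto
          also have "\<dots> = 4 * pi / real C" by (simp add: M_def)
          also have "\<dots> < \<delta>" using C g(2) \<open>C > 0\<close> by (simp add: field_simps)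
          finally show ?thesis .
        qed
        then show "\<psi> \<in> W"
          using u funpow_TS_in_characters[OF \<phi>X] funpow_TS_in_characters[OF \<psi>X] \<psi>X
          by (simp add: W_def topspace_dual_RS)
      qed
      ultimately show ?thesis by blast
    qed
    then obtain W where W: "\<And>j. j \<in> J \<Longrightarrow> W j \<in> iterated_cover (dual_RS S) ?f U n \<and> near j \<subseteq> W j"
      by metis
    have "\<Union>(W ` J) = topspace (dual_RS S)"
    proof
      show "\<Union>(W ` J) \<subseteq> topspace (dual_RS S)" using W by (force simp: iterated_cover_def)
      show "topspace (dual_RS S) \<subseteq> \<Union>(W ` J)"
      proof
        fix \<psi> assume "\<psi> \<in> topspace (dual_RS S)"
        then have \<psi>: "\<psi> \<in> ?X" by (simp add: topspace_dual_RS)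
        obtain j where "j < M" "norm (\<psi> g - cis (2 * pi * real j / real M)) \<le> 2 * pi / real M"
          using unit_circle_net[OF characters_norm[OF \<psi> g(1)] \<open>M > 0\<close>] by blast
        then have "\<psi> \<in> near j" "j \<in> J" using \<psi> by (auto simp: near_def J_def)
        then show "\<psi> \<in> \<Union>(W ` J)" using W by blast
      qed
    qed
    then have "subcover_number (dual_RS S) (iterated_cover (dual_RS S) ?f U n) \<le> card (W ` J)"
      using W \<open>finite J\<close> by (intro subcover_number_le) auto
    also have "\<dots> \<le> card J" using \<open>finite J\<close> by (rule card_image_le)
    also have "\<dots> \<le> M" by fact
    finally show ?thesis by (simp add: M_def)
  qed
  ultimately show ?thesis by (rule that)
qed

lemma topological_entropy_TS_le: "topological_entropy (dual_RS S) (TS S) \<le> ereal (ln 2)"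
  unfolding topological_entropy_def
proof (rule SUP_least)
  let ?N = "\<lambda>U n. subcover_number (dual_RS S) (iterated_cover (dual_RS S) (TS S) U n)"
  fix U assume "U \<in> {U. open_cover (dual_RS S) U}"
  then obtain C where C: "C > 0" "\<And>n. ?N U n \<le> C * 2 ^ n"
    using subcover_number_iterated_TS_le by blast
  have "ln (real (?N U n)) / real n \<le> ln (real C) / real n + ln 2" if "n > 0" for n
  proof -
    have "ln (real (?N U n)) \<le> ln (real C * 2 ^ n)"
    proof (cases "?N U n = 0")
      case True
      \<comment> \<open>As \<open>ln 0 = 0\<close>, only nonnegativity of the right-hand logarithm
        is at stake here.\<close>
      have "1 \<le> real C * 2 ^ n" using C(1) by (intro mult_ge1_I) auto
      then show ?thesis using True by simp
    next
      case False
      have "real (?N U n) \<le> real (C * 2 ^ n)" using C(2) by (simp only: of_nat_le_iff)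
      then show ?thesis using False by (intro ln_mono) auto
    qed
    also have "\<dots> = ln (real C) + real n * ln 2" using C(1) by (simp add: ln_mult ln_realpow)
    finally show ?thesis using that by (simp add: field_simps)
  qed
  then have "cover_entropy (dual_RS S) (TS S) U \<le> limsup (\<lambda>n. ereal (ln (real C) / real n + ln 2))"
    unfolding cover_entropy_def
    by (intro Limsup_mono) (auto intro: eventually_mono[OF eventually_gt_at_top[of 0]])
  also have "\<dots> = ereal (ln 2)"
  proof (rule lim_imp_Limsup)
    have "(\<lambda>n. ln (real C) / real n + ln 2) \<longlonglongrightarrow> 0 + ln 2"
      by (intro tendsto_intros lim_const_over_n)
    then show "(\<lambda>n. ereal (ln (real C) / real n + ln 2)) \<longlonglongrightarrow> ereal (ln 2)" by simp
  qed simp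
  finally show "cover_entropy (dual_RS S) (TS S) U \<le> ereal (ln 2)" .
qed

lemma topological_entropy_TS: "topological_entropy (dual_RS S) (TS S) = ereal (ln 2)"
  using topological_entropy_TS_le topological_entropy_TS_ge by (rule antisym)

section \<open>Asymptotics\<close>

text \<open>The difference of \<open>harm n\<close> and \<open>ln n\<close> decreases from its value
  1 at \<open>n = 1\<close>.\<close>

lemma harm_le_ln_plus_1: "n > 0 \<Longrightarrow> harm n \<le> ln (real n) + 1"
  using euler_mascheroni_sequence_decreasing[of 1 n] by (simp add: harm_def)

lemma MS_nonneg: "MS S N \<ge> 0"
  unfolding MS_def by (intro sum_nonneg) simp

lemma coprime_part_mersenne_ratio_le:
  assumes "n > 0"
  shows "real (coprime_part S (2 ^ n - 1)) / (real n * 2 ^ n) \<le> 1 / real n"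
proof -
  have "coprime_part S (2 ^ n - 1) \<le> 2 ^ n - 1"
    using two_power_minus_one_pos[OF assms] coprime_part_dvd by (blast intro: dvd_imp_le)
  then have "coprime_part S (2 ^ n - 1) \<le> 2 ^ n" by simp
  then have "real (coprime_part S (2 ^ n - 1)) \<le> real (2 ^ n)" by (simp only: of_nat_le_iff)
  then show ?thesis using assms by (simp add: field_simps)
qed

text \<open>The three summands come from \<open>n = 1\<close>, from composite \<open>n\<close>
  through a geometric series of ratio \<open>sqrt 2 / 2\<close>, and from prime \<open>n\<close>
  through the reciprocals of primes.\<close>

lemma MS_le_sqrt_ln:
  assumes "\<And>p. prime p \<Longrightarrow> odd p \<Longrightarrow> ord p 2 > 1 \<Longrightarrow> p \<notin> S \<Longrightarrow> prime (ord p 2)" and "N > 0"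
  shows "MS S N \<le> 1 + 4 * (1 / (1 - sqrt 2 / 2)) + sqrt (4 * ln (real N) + 2)"
proof -
  define r where "r = sqrt 2 / (2::real)"
  have r: "0 \<le> r" "r < 1" using sqrt2_less_2 by (auto simp: r_def)
  let ?t = "\<lambda>n. real (coprime_part S (2 ^ n - 1)) / (real n * 2 ^ n)"
  have t: "?t n \<le> (if n = 1 then 1 else 0) + (if prime n then 1 / real n else 0) + 4 * r ^ n"
    if "n \<in> {1..N}" for n
  proof -
    have nonneg: "0 \<le> 4 * r ^ n" using r by simp
    have le: "?t n \<le> 1 / real n"
      using that by (intro coprime_part_mersenne_ratio_le) simp
    have "n \<ge> 1" using that by simp
    then consider "n = 1" | "prime n" | "n > 1" "\<not> prime n" by linarith
    then show ?thesis
    proof cases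
      case 1
      then have "?t n \<le> 1" using le by simp
      then show ?thesis using 1 nonneg by simp
    next
      case 2
      then have "n \<noteq> 1" by auto
      then show ?thesis using 2 le nonneg by simp
    next
      case 3
      have "?t n \<le> real n * (4 * sqrt 2 ^ n) / (real n * 2 ^ n)"
        using coprime_part_mersenne_le[of S n] assms(1) 3 by (intro divide_right_mono) auto
      also have "\<dots> = 4 * r ^ n" using 3 by (simp add: r_def power_divide)
      finally show ?thesis using 3 by simp
    qed
  qed
  have "MS S N \<le> (\<Sum>n\<in>{1..N}. ?t n)" by (rule MS_le[OF topological_entropy_TS])
  also have "\<dots> \<le> (\<Sum>n\<in>{1..N}. (if n = 1 then 1 else 0) + (if prime n then 1 / real n else 0) + 4 * r ^ n)"
    by (intro sum_mono t)
  also have "\<dots> = (\<Sum>n\<in>{1..N}. if n = 1 then 1 else 0) + (\<Sum>n\<in>{1..N}. if prime n then 1 / real n else 0)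
      + 4 * (\<Sum>n\<in>{1..N}. r ^ n)"
    by (simp add: sum.distrib sum_distrib_left)
  also have "(\<Sum>n\<in>{1..N}. if n = 1 then 1 else 0) = (1::real)" using assms(2) by simp
  also have "(\<Sum>n\<in>{1..N}. if prime n then 1 / real n else 0) = (\<Sum>n\<in>{n\<in>{1..N}. prime n}. 1 / real n)"
    by (rule sum.inter_filter[symmetric]) simp
  also have "{n\<in>{1..N}. prime n} = {p. prime p \<and> p \<le> N}"
    by (auto simp: prime_gt_0_nat Suc_le_eq)
  also have "(\<Sum>n\<in>{1..N}. r ^ n) \<le> (\<Sum>n. r ^ n)"
    using r by (intro sum_le_suminf summable_geometric) auto
  also have "(\<Sum>n. r ^ n) = 1 / (1 - r)" using r by (intro suminf_geometric) auto
  also have "(\<Sum>p | prime p \<and> p \<le> N. 1 / real p) \<le> sqrt (4 * ln (real N) + 2)"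
  proof (rule real_le_rsqrt)
    have "(\<Sum>p | prime p \<and> p \<le> N. 1 / real p)\<^sup>2 \<le> 2 * harm (N\<^sup>2)"
      by (rule sum_prime_reciprocals_sq_le)
    also have "\<dots> \<le> 2 * (ln (real (N\<^sup>2)) + 1)"
      using assms(2) by (intro mult_left_mono harm_le_ln_plus_1) auto
    also have "\<dots> = 4 * ln (real N) + 2" using assms(2) by (simp add: ln_realpow)
    finally show "(\<Sum>p | prime p \<and> p \<le> N. 1 / real p)\<^sup>2 \<le> 4 * ln (real N) + 2" .
  qed
  finally show ?thesis by (simp add: r_def)
qed

lemma MS_smallo_composite_orders:
  assumes "\<And>p. prime p \<Longrightarrow> odd p \<Longrightarrow> ord p 2 > 1 \<Longrightarrow> p \<notin> S \<Longrightarrow> prime (ord p 2)"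
  shows "(\<lambda>N. MS S N) \<in> o(\<lambda>N. ln (real N))"
proof (rule landau_o.big_small_trans)
  define C where "C = 1 + 4 * (1 / (1 - sqrt 2 / 2))"
  have "\<forall>\<^sub>F N in sequentially. norm (MS S N) \<le> 1 * norm (C + sqrt (4 * ln (real N) + 2))"
    using eventually_gt_at_top[of 0]
  proof eventually_elim
    case (elim N)
    then have "MS S N \<le> C + sqrt (4 * ln (real N) + 2)"
      using MS_le_sqrt_ln[of S N] assms by (simp add: C_def)
    then show ?case using MS_nonneg[of S N] by simp
  qed
  then show "(\<lambda>N. MS S N) \<in> O(\<lambda>N. C + sqrt (4 * ln (real N) + 2))" by (rule bigoI)
  show "(\<lambda>N. C + sqrt (4 * ln (real N) + 2)) \<in> o(\<lambda>N. ln (real N))" by real_asymp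
qed

text \<open>Indices with all prime factors below \<open>Q\<close> form a bounded sum. Any other
  index has a prime factor \<open>q \<ge> Q\<close> and gains the factor
  \<open>1 / (2 ^ q - 1)\<close>, at most \<open>1 / Q\<close>.\<close>

lemma MS_le_smooth:
  assumes "\<And>p. prime p \<Longrightarrow> odd p \<Longrightarrow> prime (ord p 2) \<Longrightarrow> p \<in> S" and "Q > 0"
  shows "MS S N \<le> 2 ^ card {p. prime p \<and> p < Q} + harm N / real Q"
proof -
  let ?P = "{p. prime p \<and> p < Q}" and ?t = "\<lambda>n. real (coprime_part S (2 ^ n - 1)) / (real n * 2 ^ n)"
  have t: "?t n \<le> (if n \<in> smooth_upto ?P N then 1 / real n else 0) + 1 / real n / real Q" if n: "n \<in> {1..N}" for n
  proof (cases "n \<in> smooth_upto ?P N")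
    case True
    then show ?thesis using coprime_part_mersenne_ratio_le[of n S] n by (auto intro: add_increasing2)
  next
    case False
    then have "\<not> prime_factors n \<subseteq> ?P" using n by (simp add: smooth_upto_def)
    then obtain q where "q \<in> prime_factors n" "q \<notin> ?P" by blast
    then have q: "prime q" "q dvd n" "q \<ge> Q" by (auto simp: in_prime_factors_imp_prime)
    have "coprime_part S (2 ^ n - 1) * (2 ^ q - 1) \<le> 2 ^ n - 1"
      using coprime_part_mersenne_mult_dvd[of S n q] assms(1) q n two_power_minus_one_pos[of n]
      by (intro dvd_imp_le) auto
    then have "coprime_part S (2 ^ n - 1) * (2 ^ q - 1) \<le> 2 ^ n" by simp
    moreover have "Q \<le> 2 ^ q - 1" using q(3) less_exp[of q] by linarith
    ultimately have "coprime_part S (2 ^ n - 1) * Q \<le> 2 ^ n" by (meson mult_le_mono2 order_trans)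
    then have "real (coprime_part S (2 ^ n - 1) * Q) \<le> real (2 ^ n)" by (simp only: of_nat_le_iff)
    then show ?thesis using False n assms(2) by (simp add: field_simps)
  qed
  have "MS S N \<le> (\<Sum>n\<in>{1..N}. ?t n)" by (rule MS_le[OF topological_entropy_TS])
  also have "\<dots> \<le> (\<Sum>n\<in>{1..N}. (if n \<in> smooth_upto ?P N then 1 / real n else 0) + 1 / real n / real Q)"
    by (intro sum_mono t)
  also have "\<dots> = (\<Sum>n\<in>{1..N}. if n \<in> smooth_upto ?P N then 1 / real n else 0) + harm N / real Q"
    by (simp add: sum.distrib harm_def sum_divide_distrib inverse_eq_divide)
  also have "(\<Sum>n\<in>{1..N}. if n \<in> smooth_upto ?P N then 1 / real n else 0)
      = (\<Sum>n\<in>{n\<in>{1..N}. n \<in> smooth_upto ?P N}. 1 / real n)"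
    by (rule sum.inter_filter[symmetric]) simp
  also have "{n\<in>{1..N}. n \<in> smooth_upto ?P N} = smooth_upto ?P N" by (auto simp: smooth_upto_def)
  also have "(\<Sum>n\<in>smooth_upto ?P N. 1 / real n) \<le> 2 ^ card ?P"
    by (rule sum_smooth_reciprocals_le) auto
  finally show ?thesis by simp
qed

lemma MS_smallo_prime_orders:
  assumes "\<And>p. prime p \<Longrightarrow> odd p \<Longrightarrow> prime (ord p 2) \<Longrightarrow> p \<in> S"
  shows "(\<lambda>N. MS S N) \<in> o(\<lambda>N. ln (real N))"
proof (rule landau_o.smallI)
  fix c :: real assume "c > 0"
  obtain Q :: nat where Q: "real Q > 2 / c" using reals_Archimedean2 by blast
  then have Q': "real Q > 0" "1 / real Q \<le> c / 2"
    using \<open>c > 0\<close> less_trans[of 0 "2 / c" "real Q"] by (auto simp: field_simps)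
  \<comment> \<open>The summand \<open>c / 2\<close> absorbs the 1 in the logarithmic bound for
    \<open>harm N\<close>; the remaining half of \<open>c\<close> absorbs \<open>K\<close> once
    \<open>ln N\<close> is at least \<open>2 * K / c\<close>.\<close>
  define K where "K = (2::real) ^ card {p. prime p \<and> p < Q} + c / 2"
  have "\<forall>\<^sub>F N in sequentially. ln (real N) \<ge> 2 * K / c"
    by real_asymp
  then show "\<forall>\<^sub>F N in sequentially. norm (MS S N) \<le> c * norm (ln (real N))"
    using eventually_gt_at_top[of 0]
  proof eventually_elim
    case (elim N)
    have "MS S N \<le> 2 ^ card {p. prime p \<and> p < Q} + harm N / real Q"
      using MS_le_smooth[of S Q N] assms Q'(1) by simp
    also have "harm N / real Q \<le> (ln (real N) + 1) * (1 / real Q)"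
      using harm_le_ln_plus_1[OF elim(2)] Q'(1) by (simp add: divide_right_mono)
    also have "\<dots> \<le> (ln (real N) + 1) * (c / 2)"
      using elim(2) Q'(2) by (intro mult_left_mono) auto
    finally have "MS S N \<le> K + c / 2 * ln (real N)" by (simp add: K_def algebra_simps add_divide_distrib)
    also have "K \<le> c / 2 * ln (real N)" using elim(1) \<open>c > 0\<close> by (simp add: field_simps)
    finally show ?case using MS_nonneg[of S N] elim(2) by simp
  qed
qed

theorem mainTheorem6:
  fixes S :: "nat set"
  assumes "S = {p. prime p \<and> odd p \<and> ord p 2 > 1 \<and> \<not> prime (ord p 2)}"
  shows "(\<lambda>N. MS S N) \<in> o(\<lambda>N. ln (real N)) \<and>
         (\<lambda>N. MS ({p. prime p} - S) N) \<in> o(\<lambda>N. ln (real N))"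
proof
  show "(\<lambda>N. MS S N) \<in> o(\<lambda>N. ln (real N))"
    by (rule MS_smallo_composite_orders) (use assms in blast)
  \<comment> \<open>A prime whose order is prime is not in \<open>S\<close>, so it belongs to the
    complement.\<close>
  show "(\<lambda>N. MS ({p. prime p} - S) N) \<in> o(\<lambda>N. ln (real N))"
    by (rule MS_smallo_prime_orders) (use assms in blast)
qed

end
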